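(* Let $P$ be a fixed joint distribution of $\mathbf X=\{X_1,\dots,X_p\}$ that is faithful to a DAG with CPDAG $\mathcal G^*$, let $\mathcal D$ be data containing $n$ i.i.d. samples from $P$, and let $\phi$ be a consistent score. Let $\Phi_n=(\Phi_{n,ij})$ and $\mathbf S_n$ be the maximum p-values and corresponding separation sets recorded for any exhaustive investigation of the neighbor-based edge existence criterion (defined in the context), executed with a consistent conditional independence test applied with threshold $\alpha_n$. Let $\hat{\mathcal G}_n^{(t^* )}(\alpha_n)$ be the estimate selected by the PATH algorithm (described in the context) with parameters $\tau=1+\sum_{i<j}\mathbf 1\{\Phi_{n,ij}\le\alpha_n\}$ and $\alpha^{(\tau)}=0$ applied to $\Phi_n$ and $\mathbf S_n$. Then there exists a sequence $a_n\to0$ as $n\to\infty$ such that if $\alpha_n\ge a_n$ when $n$ is large, then $$\lim_{n\to\infty}\Pr\left[\hat{\mathcal G}_n^{(t^* )}(\alpha_n)=\mathcal G^*\right]=1.$$ In particular, this limit holds if $\alpha_n$ is fixed to some constant $\alpha\in(0,1)$ for all $n$.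
   Context: **Graphs.** $\mathbf V=\{1,\dots,p\}$, nodes $i$ are identified with variables $X_i$; $\mathbf X_{\mathbf k}=\{X_k:k\in\mathbf k\}$. An undirected edge is $i-j$, a directed edge $i\to j$. $\mathbf N_i^{\mathcal G}=\{X_j: i,j\text{ adjacent in }\mathcal G\}$. A v-structure is $i\to k\leftarrow j$ with $i,j$ not adjacent. Two DAGs are Markov equivalent if they have the same d-separation statements. The CPDAG of a DAG has the same skeleton, a directed edge for each edge oriented identically in all equivalent DAGs, and undirected edges otherwise. A consistent extension of a partially directed graph is a DAG with the same skeleton, agreeing with its directed edges and having the same v-structures. The paper's setting is that $P$ is discrete (each $X_i$ has $r_i\ge2$ states); $p$ is fixed. **Faithfulness.** $P$ and a DAG $\mathcal G$ are faithful to each other if for all disjoint $\mathbf A,\mathbf B,\mathbf C\subseteq\mathbf X$, d-separation of $\mathbf A,\mathbf B$ by $\mathbf C$ in $\mathcal G$ is equivalent to $\mathbf A\perp\!\!\!\perp\mathbf B\mid\mathbf C$ in $P$. **Consistent test.** For each distinct $i,j$ and $\mathbf k\subseteq\mathbf V\setminus\{i,j\}$, the test of $H_0:X_i\perp\!\!\!\perp X_j\mid\mathbf X_{\mathbf k}$ produces a p-value from $\mathcal D$ (e.g. the log-likelihood ratio $G^2$ test with p-value $\Pr(\chi^2_f>G^2_{ij\mid\mathbf k})$, $f=(r_i-1)(r_j-1)\prod_{k\in\mathbf k}r_k$). With threshold $\alpha_n$, independence is accepted iff the p-value is $>\alpha_n$. Consistency of the test means that the p-value is (asymptotically) $\mathrm{Unif}(0,1)$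 when $H_0$ holds and converges to $0$ in probability when $H_0$ fails. **Neighbor-based edge existence criterion.** For a DAG $\mathcal G$ faithful to $P$: $i,j$ are not connected in $\mathcal G$ if and only if there is $\mathbf X_{\mathbf k}\subseteq\mathbf N_i^{\mathcal G}\setminus\{X_j\}$ or $\mathbf X_{\mathbf k}\subseteq\mathbf N_j^{\mathcal G}\setminus\{X_i\}$ with $X_i\perp\!\!\!\perp X_j\mid\mathbf X_{\mathbf k}$ in $P$. An *exhaustive investigation* of this criterion (e.g. the skeleton phase of the PC algorithm or of its partitioned version) is a procedure that estimates a skeleton $\hat{\mathcal G}$ by testing pairs $i,j$ given conditioning sets, declaring a pair nonadjacent once a tested conditioning set gives a p-value $>\alpha_n$, and such that for every pair left connected in $\hat{\mathcal G}$ all subsets of $\mathbf N_i^{\hat{\mathcal G}}\setminus\{X_j\}$ and of $\mathbf N_j^{\hat{\mathcal G}}\setminus\{X_i\}$ have been tested. **Recorded quantities.** With $\mathcal K_{ij}$ the collection of conditioning sets $\mathbf k$ visited for the pair $i,j$, $\Phi_{n,ij}=\Phi_{n,ji}$ is the maximum over $\mathbf k\in\mathcal K_{ij}$ of the p-value of the test of $X_i\perp\!\!\!\perp X_j\mid\mathbf X_{\mathbf k}$, and $\mathbf S_n(i,j)=\mathbf S_n(j,i)$ is a maximizing $\mathbf k$. **Score.** $\phi(\mathcal G,\mathcal D)$ assigns a real number to each DAG $\mathcal G$ given data (higher is better; e.g. the Bayesian information criterion). It is decomposable (a sum over $i$ of terms depending only on $X_i$ and its parents) and score equivalent (equal on Markov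 equivalent DAGs). It is consistent if, with probability tending to one as $n\to\infty$, its maximizers over all DAGs are in the Markov equivalence class of the DAG faithful to $P$. **PATH algorithm** (inputs $\Phi_n,\mathbf S_n,\mathcal D,\tau,\alpha^{(\tau)}$). 1. Generate a decreasing sequence $\alpha^{(1)},\dots,\alpha^{(\tau)}$ from $\alpha^{(1)}=\alpha_n$ to the given $\alpha^{(\tau)}$ such that, with $\mathbf E^{(t)}=\{i-j:\Phi_{n,ij}\le\alpha^{(t)}\}$, one has $|\mathbf E^{(t)}|-|\mathbf E^{(t+1)}|\approx(|\mathbf E^{(1)}|-|\mathbf E^{(\tau)}|)/(\tau-1)$, using the order statistics of $(\Phi_{n,ij})_{i<j}$. For the parameters in the claim, with $M=\tau-1$ the number of pairs with $\Phi_{n,ij}\le\alpha_n$, this means that $\alpha^{(t)}$ for $2\le t\le M$ is the $(M+1-t)$-th smallest of the values $(\Phi_{n,ij})_{i<j}$ and $\alpha^{(M+1)}=0$, so that consecutive skeletons differ by one edge. 2. For each $t$: let $\mathcal G^{(t)}$ be the undirected graph with edges $\mathbf E^{(t)}$, and $\mathbf S^{(t)}=\{\mathbf S_n(i,j):\Phi_{n,ij}>\alpha^{(t)}\}$. Orient $\mathcal G^{(t)}$: for each $i-k-j$ with $i,j$ not adjacent and $k\notin\mathbf S^{(t)}(i,j)$, orient $i\to k\leftarrow j$; then repeatedly apply Meek's rules until none applies. Let $\tilde{\mathcal G}^{(t)}$ be a consistent extension of $\mathcal G^{(t)}$, if one exists. 3. Select $t^*\in\arg\max_t\phi(\tilde{\mathcal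 G}^{(t)},\mathcal D)$ over those $t$ for which $\mathcal G^{(t)}$ admits a consistent extension (if there are none, the graphs are scored by DAGs obtained by orienting as many edges as possible without creating cycles and removing the rest), and return $\mathcal G^{(t^* )}$. **Meek's rules.** R1: if $i\to j$, $j-k$, and $i,k$ not adjacent, orient $j\to k$. R2: if $i\to j\to k$ and $i-k$, orient $i\to k$. R3: if $i-j$, $i-k$, $i-l$, $k\to j$, $l\to j$, and $k,l$ not adjacent, orient $i\to j$. R4: if $i-j$, $i-k$, $k\to l$, $l\to j$, $i,l$ adjacent, and $k,j$ not adjacent, orient $i\to j$. *)

theory Defs
  imports "HOL-Probability.Probability"
begin

section \<open>Graphs\<close>

text \<open>
  The node set is a finite type \<open>'v\<close>, playing the role of \<open>{1, \<dots>, p}\<close>. Unordered pairs \<open>i < j\<close> of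
  nodes are two-element sets, so that everything indexed by pairs is symmetric by construction.
  A purely directed graph is its arc set; it is a DAG iff it is \<^const>\<open>acyclic\<close>.
\<close>

definition node_pairs :: "'v set set" where
  "node_pairs = {e. card e = 2}"

definition neighbors :: "'v set set \<Rightarrow> 'v \<Rightarrow> 'v set" where
  "neighbors E i = {j. {i, j} \<in> E}"

definition parents :: "('v \<times> 'v) set \<Rightarrow> 'v \<Rightarrow> 'v set" where
  "parents G i = {j. (j, i) \<in> G}"

record 'v pdag =
  undirected :: "'v set set"
  arcs :: "('v \<times> 'v) set"

definition of_digraph :: "('v \<times> 'v) set \<Rightarrow> 'v pdag" where
  "of_digraph G = \<lparr>undirected = {}, arcs = G\<rparr>"

definition skeleton :: "'v pdag \<Rightarrow> 'v set set" where
  "skeleton G = undirected G \<union> {{i, j} | i j. (i, j) \<in> arcs G}"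

definition adjacent :: "'v pdag \<Rightarrow> 'v \<Rightarrow> 'v \<Rightarrow> bool" where
  "adjacent G i j \<longleftrightarrow> {i, j} \<in> skeleton G"

definition v_structures :: "'v pdag \<Rightarrow> ('v \<times> 'v \<times> 'v) set" where
  "v_structures G =
     {(i, k, j). i \<noteq> j \<and> (i, k) \<in> arcs G \<and> (j, k) \<in> arcs G \<and> \<not> adjacent G i j}"

definition consistent_extension :: "'v pdag \<Rightarrow> ('v \<times> 'v) set \<Rightarrow> bool" where
  "consistent_extension G H \<longleftrightarrow>
     acyclic H \<and> skeleton (of_digraph H) = skeleton G \<and> arcs G \<subseteq> H \<and>
     v_structures (of_digraph H) = v_structures G"

definition is_path :: "('v \<times> 'v) set \<Rightarrow> 'v list \<Rightarrow> bool" where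
  "is_path G xs \<longleftrightarrow>
     xs \<noteq> [] \<and> distinct xs \<and>
     (\<forall>m. Suc m < length xs \<longrightarrow> (xs ! m, xs ! Suc m) \<in> G \<or> (xs ! Suc m, xs ! m) \<in> G)"

definition active_path :: "('v \<times> 'v) set \<Rightarrow> 'v set \<Rightarrow> 'v list \<Rightarrow> bool" where
  "active_path G C xs \<longleftrightarrow>
     is_path G xs \<and>
     (\<forall>m. Suc (Suc m) < length xs \<longrightarrow>
        (let a = xs ! m; b = xs ! Suc m; c = xs ! Suc (Suc m) in
         if (a, b) \<in> G \<and> (c, b) \<in> G then \<exists>d\<in>C. (b, d) \<in> G\<^sup>* else b \<notin> C))"

definition d_separated :: "('v \<times> 'v) set \<Rightarrow> 'v set \<Rightarrow> 'v set \<Rightarrow> 'v set \<Rightarrow> bool" where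
  "d_separated G A B C \<longleftrightarrow> \<not> (\<exists>xs. active_path G C xs \<and> hd xs \<in> A \<and> last xs \<in> B)"

definition markov_equivalent :: "('v \<times> 'v) set \<Rightarrow> ('v \<times> 'v) set \<Rightarrow> bool" where
  "markov_equivalent G H \<longleftrightarrow>
     (\<forall>A B C. A \<inter> B = {} \<longrightarrow> A \<inter> C = {} \<longrightarrow> B \<inter> C = {} \<longrightarrow>
        (d_separated G A B C \<longleftrightarrow> d_separated H A B C))"

definition cpdag :: "('v \<times> 'v) set \<Rightarrow> 'v pdag" where
  "cpdag G =
     (let D = {(i, j) \<in> G. \<forall>H. acyclic H \<longrightarrow> markov_equivalent G H \<longrightarrow> (i, j) \<in> H} in
      \<lparr>undirected = {{i, j} | i j. (i, j) \<in> G - D}, arcs = D\<rparr>)"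


section \<open>Distributions and data\<close>

text \<open>\<open>r i\<close> is the number of states of the \<open>i\<close>-th variable, which takes values in \<open>{..<r i}\<close>.\<close>

definition discrete_distribution :: "('v \<Rightarrow> nat) \<Rightarrow> ('v \<Rightarrow> nat) pmf \<Rightarrow> bool" where
  "discrete_distribution r P \<longleftrightarrow> (\<forall>i. 2 \<le> r i) \<and> (\<forall>x\<in>set_pmf P. \<forall>i. x i < r i)"

text \<open>
  For conditioning values of probability zero all three conditional probabilities are \<open>0\<close>
  (division by zero), so that such values impose no constraint.
\<close>

definition cond_indep :: "('v \<Rightarrow> nat) pmf \<Rightarrow> 'v set \<Rightarrow> 'v set \<Rightarrow> 'v set \<Rightarrow> bool" where
  "cond_indep P A B C \<longleftrightarrow>
     (\<forall>x. \<P>(y in measure_pmf P. (\<forall>i\<in>A. y i = x i) \<and> (\<forall>i\<in>B. y i = x i) \<bar> \<forall>i\<in>C. y i = x i) =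
          \<P>(y in measure_pmf P. \<forall>i\<in>A. y i = x i \<bar> \<forall>i\<in>C. y i = x i) *
          \<P>(y in measure_pmf P. \<forall>i\<in>B. y i = x i \<bar> \<forall>i\<in>C. y i = x i))"

definition faithful :: "('v \<Rightarrow> nat) pmf \<Rightarrow> ('v \<times> 'v) set \<Rightarrow> bool" where
  "faithful P G \<longleftrightarrow>
     (\<forall>A B C. A \<inter> B = {} \<longrightarrow> A \<inter> C = {} \<longrightarrow> B \<inter> C = {} \<longrightarrow>
        (d_separated G A B C \<longleftrightarrow> cond_indep P A B C))"

type_synonym 'v data = "('v \<Rightarrow> nat) list"

definition iid_samples :: "'w measure \<Rightarrow> (nat \<Rightarrow> 'w \<Rightarrow> 'v \<Rightarrow> nat) \<Rightarrow> ('v \<Rightarrow> nat) pmf \<Rightarrow> bool" where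
  "iid_samples M Y P \<longleftrightarrow>
     prob_space.indep_vars M (\<lambda>_. count_space UNIV) Y UNIV \<and>
     (\<forall>m. distr M (count_space UNIV) (Y m) = measure_pmf P)"

definition dataset :: "(nat \<Rightarrow> 'w \<Rightarrow> 'v \<Rightarrow> nat) \<Rightarrow> nat \<Rightarrow> 'w \<Rightarrow> 'v data" where
  "dataset Y n \<omega> = map (\<lambda>m. Y m \<omega>) [0..<n]"


section \<open>Conditional independence tests\<close>

text \<open>
  \<open>pval d {i, j} k\<close> is the p-value that the data \<open>d\<close> produce for the null hypothesis that
  \<open>X\<^sub>i\<close> and \<open>X\<^sub>j\<close> are independent given \<open>X\<^sub>k\<close>.
\<close>

definition consistent_test ::
  "'w measure \<Rightarrow> (nat \<Rightarrow> 'w \<Rightarrow> 'v \<Rightarrow> nat) \<Rightarrow> ('v \<Rightarrow> nat) pmf \<Rightarrow>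
   ('v data \<Rightarrow> 'v set \<Rightarrow> 'v set \<Rightarrow> real) \<Rightarrow> bool" where
  "consistent_test M Y P pval \<longleftrightarrow>
     (\<forall>i j k. i \<noteq> j \<longrightarrow> k \<subseteq> UNIV - {i, j} \<longrightarrow>
        (\<forall>d. pval d {i, j} k \<in> {0..1}) \<and>
        (cond_indep P {i} {j} k \<longrightarrow>
           weak_conv_m (\<lambda>n. distr M borel (\<lambda>\<omega>. pval (dataset Y n \<omega>) {i, j} k))
                       (uniform_measure lborel {0..1})) \<and>
        (\<not> cond_indep P {i} {j} k \<longrightarrow>
           (\<forall>\<epsilon>>0. (\<lambda>n. \<P>(\<omega> in M. \<bar>pval (dataset Y n \<omega>) {i, j} k\<bar> > \<epsilon>)) \<longlonglongrightarrow> 0)))"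

text \<open>
  In the following, \<open>q\<close> is the table of p-values for one data set, and \<open>K e\<close> is the collection
  of conditioning sets visited for the pair \<open>e\<close>.
\<close>

definition estimated_skeleton ::
  "('v set \<Rightarrow> 'v set \<Rightarrow> real) \<Rightarrow> real \<Rightarrow> ('v set \<Rightarrow> 'v set set) \<Rightarrow> 'v set set" where
  "estimated_skeleton q \<alpha> K = {e \<in> node_pairs. \<not> (\<exists>k\<in>K e. q e k > \<alpha>)}"

definition exhaustive_investigation ::
  "('v set \<Rightarrow> 'v set \<Rightarrow> real) \<Rightarrow> real \<Rightarrow> ('v set \<Rightarrow> 'v set set) \<Rightarrow> bool" where
  "exhaustive_investigation q \<alpha> K \<longleftrightarrow>
     (\<forall>e\<in>node_pairs. \<forall>k\<in>K e. k \<subseteq> UNIV - e) \<and>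
     (let E = estimated_skeleton q \<alpha> K in
      \<forall>i j. {i, j} \<in> E \<longrightarrow>
        (\<forall>k. k \<subseteq> neighbors E i - {j} \<or> k \<subseteq> neighbors E j - {i} \<longrightarrow> k \<in> K {i, j}))"

definition max_pvalue ::
  "('v set \<Rightarrow> 'v set \<Rightarrow> real) \<Rightarrow> ('v set \<Rightarrow> 'v set set) \<Rightarrow> 'v set \<Rightarrow> real" where
  "max_pvalue q K e = Max (q e ` K e)"

definition recorded_sepsets ::
  "('v set \<Rightarrow> 'v set \<Rightarrow> real) \<Rightarrow> ('v set \<Rightarrow> 'v set set) \<Rightarrow> ('v set \<Rightarrow> 'v set) \<Rightarrow> bool" where
  "recorded_sepsets q K S \<longleftrightarrow> (\<forall>e\<in>node_pairs. S e \<in> K e \<and> q e (S e) = max_pvalue q K e)"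


section \<open>Scores\<close>

text \<open>\<open>\<phi> G d\<close> is the score of the DAG \<open>G\<close> given the data \<open>d\<close>.\<close>

definition decomposable_score :: "(('v::finite \<times> 'v) set \<Rightarrow> 'v data \<Rightarrow> real) \<Rightarrow> bool" where
  "decomposable_score \<phi> \<longleftrightarrow>
     (\<exists>s :: 'v \<Rightarrow> 'v set \<Rightarrow> 'v data \<Rightarrow> real.
        (\<forall>G d. acyclic G \<longrightarrow> \<phi> G d = (\<Sum>i\<in>UNIV. s i (parents G i) d)) \<and>
        (\<forall>i Q d d'. map (\<lambda>x. restrict x (insert i Q)) d = map (\<lambda>x. restrict x (insert i Q)) d'
           \<longrightarrow> s i Q d = s i Q d'))"

definition score_equivalent :: "(('v \<times> 'v) set \<Rightarrow> 'v data \<Rightarrow> real) \<Rightarrow> bool" where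
  "score_equivalent \<phi> \<longleftrightarrow>
     (\<forall>G H d. acyclic G \<longrightarrow> acyclic H \<longrightarrow> markov_equivalent G H \<longrightarrow> \<phi> G d = \<phi> H d)"

definition consistent_score ::
  "'w measure \<Rightarrow> (nat \<Rightarrow> 'w \<Rightarrow> 'v \<Rightarrow> nat) \<Rightarrow> ('v \<Rightarrow> nat) pmf \<Rightarrow>
   (('v \<times> 'v) set \<Rightarrow> 'v data \<Rightarrow> real) \<Rightarrow> bool" where
  "consistent_score M Y P \<phi> \<longleftrightarrow>
     (\<forall>G\<^sub>0. acyclic G\<^sub>0 \<longrightarrow> faithful P G\<^sub>0 \<longrightarrow>
        (\<lambda>n. \<P>(\<omega> in M. \<forall>G. is_arg_max (\<lambda>H. \<phi> H (dataset Y n \<omega>)) acyclic G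
                       \<longrightarrow> markov_equivalent G\<^sub>0 G)) \<longlonglongrightarrow> 1)"


section \<open>The PATH algorithm\<close>

text \<open>\<open>order_statistic \<Phi> m\<close> is the \<open>m\<close>-th smallest (\<open>m \<ge> 1\<close>), with multiplicity, of the values
  \<open>\<Phi> {i, j}\<close>.\<close>

definition order_statistic :: "('v::finite set \<Rightarrow> real) \<Rightarrow> nat \<Rightarrow> real" where
  "order_statistic \<Phi> m = sorted_list_of_multiset (image_mset \<Phi> (mset_set node_pairs)) ! (m - 1)"

definition edges_at :: "('v set \<Rightarrow> real) \<Rightarrow> real \<Rightarrow> 'v set set" where
  "edges_at \<Phi> \<alpha> = {e \<in> node_pairs. \<Phi> e \<le> \<alpha>}"

definition num_thresholds :: "('v set \<Rightarrow> real) \<Rightarrow> real \<Rightarrow> nat" where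
  "num_thresholds \<Phi> \<alpha> = 1 + card (edges_at \<Phi> \<alpha>)"

text \<open>
  The thresholds \<open>\<alpha>\<^sup>(\<^sup>1\<^sup>), \<dots>, \<alpha>\<^sup>(\<^sup>\<tau>\<^sup>)\<close> for \<open>\<tau> = num_thresholds \<Phi> \<alpha>\<close> and final value \<open>0\<close>. If \<open>\<tau> = 1\<close>, the
  requirements \<open>\<alpha>\<^sup>(\<^sup>1\<^sup>) = \<alpha>\<close> and \<open>\<alpha>\<^sup>(\<^sup>\<tau>\<^sup>) = 0\<close> compete and the former is kept; for \<open>\<alpha> \<ge> 0\<close> both give
  the empty skeleton.
\<close>

definition path_threshold :: "('v::finite set \<Rightarrow> real) \<Rightarrow> real \<Rightarrow> nat \<Rightarrow> real" where
  "path_threshold \<Phi> \<alpha> t =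
     (let M = num_thresholds \<Phi> \<alpha> - 1 in
      if t = 1 then \<alpha> else if t \<le> M then order_statistic \<Phi> (M + 1 - t) else 0)"

definition collider_arcs :: "'v set set \<Rightarrow> ('v set \<Rightarrow> 'v set) \<Rightarrow> ('v \<times> 'v) set" where
  "collider_arcs E S =
     {(i, k). \<exists>j. i \<noteq> j \<and> {i, k} \<in> E \<and> {k, j} \<in> E \<and> {i, j} \<notin> E \<and> k \<notin> S {i, j}}"

text \<open>
  If the recorded separating sets demand both orientations of an edge, then any way of resolving
  the conflict (either orientation, or both at once) is admitted.
\<close>

definition collider_orientation ::
  "'v set set \<Rightarrow> ('v set \<Rightarrow> 'v set) \<Rightarrow> 'v pdag \<Rightarrow> bool" where
  "collider_orientation E S G \<longleftrightarrow>
     arcs G \<subseteq> collider_arcs E S \<and>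
     (\<forall>(i, k) \<in> collider_arcs E S. (i, k) \<in> arcs G \<or> (k, i) \<in> arcs G) \<and>
     undirected G = E - {{i, k} | i k. (i, k) \<in> arcs G}"

definition orient :: "'v \<Rightarrow> 'v \<Rightarrow> 'v pdag \<Rightarrow> 'v pdag" where
  "orient i j G = \<lparr>undirected = undirected G - {{i, j}}, arcs = insert (i, j) (arcs G)\<rparr>"

inductive meek_step :: "'v pdag \<Rightarrow> 'v pdag \<Rightarrow> bool" where
  R1: "(i, j) \<in> arcs G \<Longrightarrow> {j, k} \<in> undirected G \<Longrightarrow> i \<noteq> k \<Longrightarrow> \<not> adjacent G i k
       \<Longrightarrow> meek_step G (orient j k G)"
| R2: "(i, j) \<in> arcs G \<Longrightarrow> (j, k) \<in> arcs G \<Longrightarrow> {i, k} \<in> undirected G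
       \<Longrightarrow> meek_step G (orient i k G)"
| R3: "{i, j} \<in> undirected G \<Longrightarrow> {i, k} \<in> undirected G \<Longrightarrow> {i, l} \<in> undirected G \<Longrightarrow>
       (k, j) \<in> arcs G \<Longrightarrow> (l, j) \<in> arcs G \<Longrightarrow> k \<noteq> l \<Longrightarrow> \<not> adjacent G k l
       \<Longrightarrow> meek_step G (orient i j G)"
| R4: "{i, j} \<in> undirected G \<Longrightarrow> {i, k} \<in> undirected G \<Longrightarrow> (k, l) \<in> arcs G \<Longrightarrow>
       (l, j) \<in> arcs G \<Longrightarrow> adjacent G i l \<Longrightarrow> k \<noteq> j \<Longrightarrow> \<not> adjacent G k j
       \<Longrightarrow> meek_step G (orient i j G)"

definition oriented_graph :: "'v set set \<Rightarrow> ('v set \<Rightarrow> 'v set) \<Rightarrow> 'v pdag \<Rightarrow> bool" where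
  "oriented_graph E S G \<longleftrightarrow>
     (\<exists>G\<^sub>0. collider_orientation E S G\<^sub>0 \<and> meek_step\<^sup>*\<^sup>* G\<^sub>0 G) \<and> \<not> (\<exists>G'. meek_step G G')"

text \<open>
  The DAGs scored when no graph on the path has a consistent extension: as many edges as
  possible are oriented (respecting the given directions) without creating cycles, and the
  rest is removed.
\<close>

definition partial_orientation :: "'v pdag \<Rightarrow> ('v \<times> 'v) set \<Rightarrow> bool" where
  "partial_orientation G H \<longleftrightarrow>
     acyclic H \<and> H \<subseteq> arcs G \<union> {(i, j). {i, j} \<in> undirected G}"

definition fallback_dag :: "'v pdag \<Rightarrow> ('v \<times> 'v) set \<Rightarrow> bool" where
  "fallback_dag G H \<longleftrightarrow> is_arg_max card (partial_orientation G) H"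

text \<open>
  \<open>path_output \<phi> d S \<Phi> \<tau> \<alpha>s G\<close>: \<open>G\<close> is a possible output of the algorithm for the thresholds
  \<open>\<alpha>s 1, \<dots>, \<alpha>s \<tau>\<close>. The predicate is relational since the order of rule applications, the
  choice of extensions and the choice among maximizers are not determined.
  Note that \<open>\<Phi> {i, j} > \<alpha>s t\<close> holds for all pairs that are not adjacent at stage \<open>t\<close>, so
  \<open>S\<close> itself can be used in place of its restriction to these pairs.
\<close>

definition path_output ::
  "(('v \<times> 'v) set \<Rightarrow> 'v data \<Rightarrow> real) \<Rightarrow> 'v data \<Rightarrow> ('v set \<Rightarrow> 'v set) \<Rightarrow>
   ('v set \<Rightarrow> real) \<Rightarrow> nat \<Rightarrow> (nat \<Rightarrow> real) \<Rightarrow> 'v pdag \<Rightarrow> bool" where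
  "path_output \<phi> d S \<Phi> \<tau> \<alpha>s G \<longleftrightarrow>
     (\<exists>(\<G> :: nat \<Rightarrow> 'v pdag) (\<H> :: nat \<Rightarrow> ('v \<times> 'v) set) ts.
        (\<forall>t\<in>{1..\<tau>}. oriented_graph (edges_at \<Phi> (\<alpha>s t)) S (\<G> t)) \<and>
        (let T = {t \<in> {1..\<tau>}. \<exists>H. consistent_extension (\<G> t) H} in
         if T \<noteq> {} then
           (\<forall>t\<in>T. consistent_extension (\<G> t) (\<H> t)) \<and>
           is_arg_max (\<lambda>t. \<phi> (\<H> t) d) (\<lambda>t. t \<in> T) ts
         else
           (\<forall>t\<in>{1..\<tau>}. fallback_dag (\<G> t) (\<H> t)) \<and>
           is_arg_max (\<lambda>t. \<phi> (\<H> t) d) (\<lambda>t. t \<in> {1..\<tau>}) ts) \<and>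
        G = \<G> ts)"

text \<open>
  \<open>path_estimate pval \<phi> \<alpha> d G\<close>: \<open>G\<close> can be obtained from the data \<open>d\<close> by an exhaustive
  investigation with threshold \<open>\<alpha>\<close>, followed by the PATH algorithm with
  \<open>\<tau> = 1 + |{i < j. \<Phi>\<^sub>i\<^sub>j \<le> \<alpha>}|\<close> and final threshold \<open>0\<close>.
\<close>

definition path_estimate ::
  "('v::finite data \<Rightarrow> 'v set \<Rightarrow> 'v set \<Rightarrow> real) \<Rightarrow> (('v \<times> 'v) set \<Rightarrow> 'v data \<Rightarrow> real) \<Rightarrow>
   real \<Rightarrow> 'v data \<Rightarrow> 'v pdag \<Rightarrow> bool" where
  "path_estimate pval \<phi> \<alpha> d G \<longleftrightarrow>
     (\<exists>K S. exhaustive_investigation (pval d) \<alpha> K \<and> recorded_sepsets (pval d) K S \<and>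
        (let \<Phi> = max_pvalue (pval d) K in
         path_output \<phi> d S \<Phi> (num_thresholds \<Phi> \<alpha>) (path_threshold \<Phi> \<alpha>) G))"

end

theory Submission
  imports Defs
begin

text \<open>
  By consistency of the test and a diagonal argument there is \<open>a\<^sub>n \<rightarrow> 0\<close> such that, with probability
  tending to one, the p-values of all false hypotheses are at most \<open>a\<^sub>n\<close> while those of all true ones,
  being asymptotically uniform, exceed \<open>a\<^sub>n\<close>. On this event, and if \<open>\<alpha>\<^sub>n \<ge> a\<^sub>n\<close>, no true edge is lost,
  hence the separating sets of all nonadjacent pairs are tested: the recorded maxima are at most
  \<open>a\<^sub>n\<close> exactly for the true edges, and the recorded sets separate. The thresholds run
  through the order statistics, so the true skeleton occurs on the path, and orienting it yields the
  CPDAG, by Meek's theorem. Its extensions are Markov equivalent to the true DAG and thus maximize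
  the score over all DAGs, so the selected graph has the true skeleton, too.

  Markov equivalence of DAGs with the same skeleton and the same v-structures is obtained by
  Chickering's reversals of covered edges.
\<close>

section \<open>d-connection as reachability\<close>

text \<open>Only the order of the recorded maxima matters, which is why the threshold need not tend
  to zero: a large one leaves false edges in the first skeleton, and with high probability the path
  removes them before any true edge. The level \<open>a n\<close> is an artificial cut between the
  two groups. It is constructed from the false hypotheses alone, whose p-values vanish at unknown
  rates; for the true ones any null sequence will do, because the probability of a p-value below
  \<open>a n\<close> is eventually at most that of a p-value below a fixed \<open>x\<close> in
  \<open>(0,1)\<close>, which tends to \<open>x\<close>.

  The CPDAG is defined by the d-separation statements of all equivalent DAGs, so both directions of
  the pattern criterion are needed: equal patterns must give equivalent DAGs, to reverse undirected
  edges and to compare scores, and equivalent DAGs must have equal patterns, to see that the arcs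
  found are common to the class. A path rerouted around a reversed edge may lose its distinctness;
  walks avoid this, hence \<open>d_reach\<close>.\<close>

text \<open>
  A walk on which exactly the colliders lie in \<open>C\<close> is followed node by node; the flag records
  whether the last edge points into the current node. A collider with a descendant in \<open>C\<close> is
  passed by walking down to \<open>C\<close> and back.
\<close>

inductive d_reach :: "('v \<times> 'v) set \<Rightarrow> 'v set \<Rightarrow> 'v \<Rightarrow> 'v \<Rightarrow> bool \<Rightarrow> bool"
  for G C a where
  start: "d_reach G C a a False"
| down: "d_reach G C a b m \<Longrightarrow> b \<notin> C \<Longrightarrow> (b, c) \<in> G \<Longrightarrow> d_reach G C a c True"
| up: "d_reach G C a b m \<Longrightarrow> (c, b) \<in> G \<Longrightarrow> (m \<longleftrightarrow> b \<in> C) \<Longrightarrow> d_reach G C a c False"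

definition d_connected :: "('v \<times> 'v) set \<Rightarrow> 'v set \<Rightarrow> 'v \<Rightarrow> 'v \<Rightarrow> bool" where
  "d_connected G C a b \<longleftrightarrow> (\<exists>m. d_reach G C a b m)"

text \<open>Active paths, listed from their end to their start.\<close>

inductive rev_active :: "('v \<times> 'v) set \<Rightarrow> 'v set \<Rightarrow> 'v \<Rightarrow> 'v list \<Rightarrow> bool \<Rightarrow> bool"
  for G C a where
  start: "rev_active G C a [a] False"
| down: "rev_active G C a (b # xs) m \<Longrightarrow> b \<notin> C \<Longrightarrow> (b, c) \<in> G \<Longrightarrow> c \<notin> set (b # xs)
    \<Longrightarrow> rev_active G C a (c # b # xs) True"
| up: "rev_active G C a (b # xs) m \<Longrightarrow> (c, b) \<in> G \<Longrightarrow>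
    (if m then \<exists>d\<in>C. (b, d) \<in> G\<^sup>* else b \<notin> C) \<Longrightarrow> c \<notin> set (b # xs)
    \<Longrightarrow> rev_active G C a (c # b # xs) False"

section \<open>Walks and active paths\<close>

lemma d_reach_turn:
  assumes "(b, d) \<in> G\<^sup>*" "d \<in> C" "d_reach G C a b m"
  shows "b \<in> C \<or> d_reach G C a b False"
  using assms
proof (induction arbitrary: m rule: converse_rtrancl_induct)
  case (step b b')
  show ?case
  proof (cases "b \<in> C")
    case False
    then have reach: "d_reach G C a b' True"
      using d_reach.down[OF step.prems(2) False step.hyps(1)] by simp
    show ?thesis
    proof (cases "b' \<in> C")
      case True
      then show ?thesis using d_reach.up[OF reach step.hyps(1)] by simp
    next
      case False
      then have "d_reach G C a b' False"
        using step.IH[OF step.prems(1) reach] by simp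
      then show ?thesis using d_reach.up[OF _ step.hyps(1)] False by blast
    qed
  qed simp
qed simp

lemma rev_active_imp_d_reach:
  assumes "rev_active G C a xs m"
  shows "xs \<noteq> [] \<and> d_reach G C a (hd xs) m"
  using assms
proof (induction rule: rev_active.induct)
  case start
  then show ?case by (simp add: d_reach.start)
next
  case (down b xs m c)
  then show ?case using d_reach.down by fastforce
next
  case (up b xs m c)
  then have reach: "d_reach G C a b m" by simp
  show ?case
  proof (cases "m \<longleftrightarrow> b \<in> C")
    case True
    then show ?thesis using d_reach.up[OF reach up.hyps(2)] by simp
  next
    \<comment> \<open>Here \<open>b\<close> is a collider outside \<open>C\<close> with a descendant
      in \<open>C\<close>; the detour down and back returns to \<open>b\<close> with flag
      \<open>False\<close>, from where the walk may go up.\<close>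
    case False
    with up.hyps(3) obtain d where "d \<in> C" "(b, d) \<in> G\<^sup>*" "b \<notin> C"
      by (auto split: if_splits)
    then have "d_reach G C a b False" using d_reach_turn reach by metis
    then show ?thesis using d_reach.up[OF _ up.hyps(2)] \<open>b \<notin> C\<close> by auto
  qed
qed

text \<open>Needed when a walk returns to a node \<open>c\<close> of the path built so far, which is then cut at \<open>c\<close>.\<close>

lemma rev_active_cut:
  assumes "rev_active G C a (us @ c # vs) m" "us \<noteq> []"
  shows "\<exists>m0. rev_active G C a (c # vs) m0 \<and> (c \<in> C \<longrightarrow> m0) \<and>
    (\<not> m0 \<or> (\<exists>d\<in>C. (c, d) \<in> G\<^sup>*) \<or> (m \<and> (c, hd us) \<in> G\<^sup>*))"
  using assms
\<comment> \<open>If \<open>m0\<close> holds, follow the path on from \<open>c\<close>: its arcs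
  point forward up to a first collider, which is an ancestor of \<open>C\<close>, or all the way to
  \<open>hd us\<close>.\<close>
proof (induction us arbitrary: m)
  case (Cons b us)
  show ?case
  proof (cases us)
    case Nil
    with Cons.prems have "rev_active G C a (b # c # vs) m" by simp
    then show ?thesis
      by (cases rule: rev_active.cases) (auto simp: Nil split: if_splits)
  next
    case (Cons b' us')
    with Cons.prems have "rev_active G C a (b # b' # us' @ c # vs) m" by simp
    then show ?thesis
    proof (cases rule: rev_active.cases)
      case (down m')
      from Cons.IH[of m'] down Cons obtain m0 where
        "rev_active G C a (c # vs) m0" "c \<in> C \<longrightarrow> m0"
        "\<not> m0 \<or> (\<exists>d\<in>C. (c, d) \<in> G\<^sup>*) \<or> (m' \<and> (c, b') \<in> G\<^sup>*)" by auto
      then show ?thesis using down by (intro exI[of _ m0]) (auto intro: rtrancl_into_rtrancl)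
    next
      case (up m')
      from Cons.IH[of m'] up Cons obtain m0 where
        "rev_active G C a (c # vs) m0" "c \<in> C \<longrightarrow> m0"
        "\<not> m0 \<or> (\<exists>d\<in>C. (c, d) \<in> G\<^sup>*) \<or> (m' \<and> (c, b') \<in> G\<^sup>*)" by auto
      moreover have "\<exists>d\<in>C. (c, d) \<in> G\<^sup>*" if "m'" "(c, b') \<in> G\<^sup>*"
        using that up by (auto intro: rtrancl_trans)
      ultimately show ?thesis by blast
    qed
  qed
qed simp

text \<open>The path may enter \<open>b\<close> with another flag than the walk does. The second
  conjunct is the invariant that survives cutting: where the walk may leave \<open>b\<close> against
  an arc, so may the path. Leaving along an arc requires \<open>b\<close> outside \<open>C\<close>
  in both cases.\<close>

lemma d_reach_imp_rev_active:
  assumes "d_reach G C a b m" "acyclic G"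
  shows "\<exists>xs m'. rev_active G C a (b # xs) m' \<and>
    ((m \<longleftrightarrow> b \<in> C) \<longrightarrow> (if m' then \<exists>d\<in>C. (b, d) \<in> G\<^sup>* else b \<notin> C))"
  using assms(1)
proof (induction rule: d_reach.induct)
  case start
  have "rev_active G C a [a] False" by (rule rev_active.start)
  then show ?case by auto
next
  case (down b m c)
  from down.IH obtain xs m' where p: "rev_active G C a (b # xs) m'" by blast
  have "c \<noteq> b" using down.hyps(3) assms(2) by (auto simp: acyclic_def)
  show ?case
  proof (cases "c \<in> set xs")
    case False
    then show ?thesis
      using rev_active.down[OF p down.hyps(2,3)] \<open>c \<noteq> b\<close>
      by (intro exI[of _ "b # xs"] exI[of _ True]) auto
  next
    case True
    then obtain us vs where "xs = us @ c # vs" by (meson split_list)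
    then obtain m0 where "rev_active G C a (c # vs) m0" "c \<in> C \<longrightarrow> m0"
      using rev_active_cut[of G C a "b # us" c vs m'] p by auto
    then show ?thesis by (intro exI[of _ vs] exI[of _ m0]) auto
  qed
next
  case (up b m c)
  from up.IH up.hyps(3) obtain xs m' where p: "rev_active G C a (b # xs) m'"
    "if m' then \<exists>d\<in>C. (b, d) \<in> G\<^sup>* else b \<notin> C" by blast
  have "c \<noteq> b" using up.hyps(2) assms(2) by (auto simp: acyclic_def)
  show ?case
  proof (cases "c \<in> set xs")
    case False
    then show ?thesis
      using rev_active.up[OF p(1) up.hyps(2) p(2)] \<open>c \<noteq> b\<close>
      by (intro exI[of _ "b # xs"] exI[of _ False]) auto
  next
    case True
    then obtain us vs where "xs = us @ c # vs" by (meson split_list)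
    then obtain m0 where "rev_active G C a (c # vs) m0" "c \<in> C \<longrightarrow> m0"
      "\<not> m0 \<or> (\<exists>d\<in>C. (c, d) \<in> G\<^sup>*) \<or> (m' \<and> (c, b) \<in> G\<^sup>*)"
      using rev_active_cut[of G C a "b # us" c vs m'] p by auto
    moreover have "\<exists>d\<in>C. (c, d) \<in> G\<^sup>*" if "m'"
      using that p(2) up.hyps(2) by (auto intro: converse_rtrancl_into_rtrancl)
    ultimately show ?thesis by (intro exI[of _ vs] exI[of _ m0]) auto
  qed
qed

section \<open>Active paths as lists of nodes\<close>

lemma active_path_singleton: "active_path G C [a]"
  by (simp add: active_path_def is_path_def)

lemma active_path_snoc:
  assumes "ys \<noteq> []"
  shows "active_path G C (ys @ [c]) \<longleftrightarrow>
    active_path G C ys \<and> c \<notin> set ys \<and> ((last ys, c) \<in> G \<or> (c, last ys) \<in> G) \<and>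
    (2 \<le> length ys \<longrightarrow>
      (if (ys ! (length ys - 2), last ys) \<in> G \<and> (c, last ys) \<in> G
       then \<exists>d\<in>C. (last ys, d) \<in> G\<^sup>* else last ys \<notin> C))"
proof -
  obtain zs b where ys: "ys = zs @ [b]" using assms by (metis rev_exhaust)
  have split1: "(\<forall>m. Suc m < Suc (length ys) \<longrightarrow> Q m) \<longleftrightarrow>
     (\<forall>m. Suc m < length ys \<longrightarrow> Q m) \<and> Q (length ys - 1)" for Q
    unfolding ys by (auto simp: less_Suc_eq)
  have split2: "(\<forall>m. Suc (Suc m) < Suc (length ys) \<longrightarrow> Q m) \<longleftrightarrow>
     (\<forall>m. Suc (Suc m) < length ys \<longrightarrow> Q m) \<and> (2 \<le> length ys \<longrightarrow> Q (length ys - 2))" for Q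
    unfolding ys by (cases "length zs") (auto simp: less_Suc_eq)
  have "is_path G (ys @ [c]) \<longleftrightarrow>
      is_path G ys \<and> c \<notin> set ys \<and> ((last ys, c) \<in> G \<or> (c, last ys) \<in> G)"
    using assms unfolding is_path_def length_append_singleton split1
    by (auto simp: nth_append last_conv_nth)
  then show ?thesis
    using assms unfolding active_path_def length_append_singleton split2 Let_def
    by (auto simp: nth_append last_conv_nth numeral_2_eq_2 Suc_diff_Suc)
qed

lemma active_path_imp_rev_active:
  assumes "active_path G C xs" "hd xs \<notin> C" "acyclic G"
  shows "rev_active G C (hd xs) (rev xs) (2 \<le> length xs \<and> (xs ! (length xs - 2), last xs) \<in> G)"
  using assms(1,2)
proof (induction xs rule: rev_induct)
  case Nil
  then show ?case by (simp add: active_path_def is_path_def)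
next
  case (snoc c ys)
  show ?case
  proof (cases "ys = []")
    case True
    then show ?thesis by (simp add: rev_active.start)
  next
    case False
    let ?m = "2 \<le> length ys \<and> (ys ! (length ys - 2), last ys) \<in> G"
    have ys: "active_path G C ys" "c \<notin> set ys"
      and adj: "(last ys, c) \<in> G \<or> (c, last ys) \<in> G"
      and step: "2 \<le> length ys \<Longrightarrow>
        (if (ys ! (length ys - 2), last ys) \<in> G \<and> (c, last ys) \<in> G
         then \<exists>d\<in>C. (last ys, d) \<in> G\<^sup>* else last ys \<notin> C)"
      using snoc.prems(1) active_path_snoc[OF False, of G C c] by auto
    have hd: "hd (ys @ [c]) = hd ys" using False by simp
    have rev: "rev ys = last ys # rev (butlast ys)" using False
      by (metis append_butlast_last_id rev_eq_Cons_iff rev_rev_ident)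
    have notin: "c \<notin> set (last ys # rev (butlast ys))"
      using rev ys(2) by (metis set_rev)
    have IH: "rev_active G C (hd ys) (last ys # rev (butlast ys)) ?m"
      using snoc.IH[OF ys(1)] snoc.prems(2) hd rev by simp
    \<comment> \<open>\<open>active_path\<close> restricts inner nodes only, whereas
      \<open>rev_active\<close> requires its first node to be outside \<open>C\<close> before
      leaving it. For a single node the assumption on \<open>hd xs\<close> supplies this.\<close>
    have one: "last ys = hd ys" if "\<not> 2 \<le> length ys"
      using that False by (cases ys) (auto simp: Suc_le_eq)
    have prev: "(ys @ [c]) ! (length (ys @ [c]) - 2) = last ys"
      using False by (simp add: nth_append last_conv_nth)
    have anti: "\<not> ((last ys, c) \<in> G \<and> (c, last ys) \<in> G)"
      using assms(3) by (meson acyclic_def trancl.intros)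
    show ?thesis
    proof (cases "(last ys, c) \<in> G")
      case True
      then have "last ys \<notin> C" using anti step one snoc.prems(2) hd by metis
      from rev_active.down[OF IH this True notin] show ?thesis
        using True prev hd False by (simp add: rev numeral_2_eq_2 Suc_le_eq)
    next
      case nd: False
      then have "(c, last ys) \<in> G" using adj by simp
      moreover have "if ?m then \<exists>d\<in>C. (last ys, d) \<in> G\<^sup>* else last ys \<notin> C"
        using step one snoc.prems(2) hd \<open>(c, last ys) \<in> G\<close> by (cases "2 \<le> length ys") auto
      ultimately show ?thesis
        using rev_active.up[OF IH _ _ notin] nd prev hd False by (simp add: rev)
    qed
  qed
qed

lemma rev_active_imp_active_path:
  assumes "rev_active G C a xs m" "acyclic G"
  shows "active_path G C (rev xs) \<and> hd (rev xs) = a \<and> xs \<noteq> [] \<and>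
    m = (2 \<le> length xs \<and> (xs ! 1, hd xs) \<in> G)"
  using assms(1)
proof (induction rule: rev_active.induct)
  case start
  then show ?case by (simp add: active_path_singleton)
next
  case (down b xs m c)
  have "(c, b) \<notin> G" using down.hyps(3) assms(2) by (meson acyclic_def trancl.intros)
  moreover have "hd (rev (c # b # xs)) = hd (rev (b # xs))" by (simp add: hd_append)
  ultimately show ?case
    using down active_path_snoc[of "rev (b # xs)" G C c] by simp
next
  case (up b xs m c)
  have "(b, c) \<notin> G" using up.hyps(2) assms(2) by (meson acyclic_def trancl.intros)
  moreover have "hd (rev (c # b # xs)) = hd (rev (b # xs))" by (simp add: hd_append)
  moreover have "rev (b # xs) ! (length (rev (b # xs)) - 2) = (b # xs) ! 1"
    if "2 \<le> length (b # xs)"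
    using that by (subst rev_nth) auto
  ultimately show ?case
    using up active_path_snoc[of "rev (b # xs)" G C c] by (simp split: if_splits)
qed

lemma d_connected_iff_active_path:
  assumes "acyclic G" "a \<notin> C"
  shows "d_connected G C a b \<longleftrightarrow> (\<exists>xs. active_path G C xs \<and> hd xs = a \<and> last xs = b)"
proof
  assume "d_connected G C a b"
  then obtain m where "d_reach G C a b m" unfolding d_connected_def ..
  from d_reach_imp_rev_active[OF this assms(1)]
  obtain xs m' where "rev_active G C a (b # xs) m'" by blast
  from rev_active_imp_active_path[OF this assms(1)]
  show "\<exists>xs. active_path G C xs \<and> hd xs = a \<and> last xs = b" by fastforce
next
  assume "\<exists>xs. active_path G C xs \<and> hd xs = a \<and> last xs = b"
  then obtain xs where xs: "active_path G C xs" "hd xs = a" "last xs = b" by blast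
  then have "hd (rev xs) = b" by (simp add: hd_rev)
  moreover have "hd xs \<notin> C" using xs(2) assms(2) by simp
  ultimately show "d_connected G C a b"
    using rev_active_imp_d_reach[OF active_path_imp_rev_active[OF xs(1) _ assms(1)]] xs(2)
    unfolding d_connected_def by metis
qed

lemma d_separated_iff_not_d_connected:
  assumes "acyclic G" "A \<inter> C = {}"
  shows "d_separated G A B C \<longleftrightarrow> (\<forall>a\<in>A. \<forall>b\<in>B. \<not> d_connected G C a b)"
proof -
  have "d_connected G C a b \<longleftrightarrow> (\<exists>xs. active_path G C xs \<and> hd xs = a \<and> last xs = b)"
    if "a \<in> A" for a b
    using d_connected_iff_active_path[OF assms(1)] that assms(2) by blast
  then show ?thesis unfolding d_separated_def by simp blast
qed

section \<open>Markov equivalence\<close>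

definition linked :: "('v \<times> 'v) set \<Rightarrow> 'v \<Rightarrow> 'v \<Rightarrow> bool" where
  "linked G i j \<longleftrightarrow> (i, j) \<in> G \<or> (j, i) \<in> G"

definition unshielded_collider :: "('v \<times> 'v) set \<Rightarrow> 'v \<Rightarrow> 'v \<Rightarrow> 'v \<Rightarrow> bool" where
  "unshielded_collider G i k j \<longleftrightarrow> (i, k) \<in> G \<and> (j, k) \<in> G \<and> i \<noteq> j \<and> \<not> linked G i j"

text \<open>The Verma--Pearl criterion for Markov equivalence.\<close>

definition same_pattern :: "('v \<times> 'v) set \<Rightarrow> ('v \<times> 'v) set \<Rightarrow> bool" where
  "same_pattern G H \<longleftrightarrow> linked G = linked H \<and> unshielded_collider G = unshielded_collider H"

lemma same_pattern_trans: "same_pattern G H \<Longrightarrow> same_pattern H K \<Longrightarrow> same_pattern G K"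
  by (simp add: same_pattern_def)

lemma same_pattern_sym: "same_pattern G H \<Longrightarrow> same_pattern H G"
  by (simp add: same_pattern_def)

lemma linked_sym: "linked G i j \<Longrightarrow> linked G j i"
  by (auto simp: linked_def)

lemma acyclic_no_2cycle: "acyclic G \<Longrightarrow> (a, b) \<in> G \<Longrightarrow> (b, a) \<notin> G"
  by (meson acyclic_def trancl.intros)

lemma acyclic_no_loop: "acyclic G \<Longrightarrow> (a, a) \<notin> G"
  by (meson acyclic_def trancl.intros)

lemma acyclic_no_3cycle: "acyclic G \<Longrightarrow> (a, b) \<in> G \<Longrightarrow> (b, c) \<in> G \<Longrightarrow> (c, a) \<notin> G"
  by (meson acyclic_def trancl.intros)

lemma in_skeleton_of_digraph: "{i, j} \<in> skeleton (of_digraph G) \<longleftrightarrow> linked G i j"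
  by (auto simp: skeleton_def of_digraph_def linked_def doubleton_eq_iff)

lemma skeleton_of_digraph_eq_iff:
  "skeleton (of_digraph G) = skeleton (of_digraph H) \<longleftrightarrow> linked G = linked H"
proof
  assume "linked G = linked H"
  then have eq: "{i, j} \<in> skeleton (of_digraph G) \<longleftrightarrow> {i, j} \<in> skeleton (of_digraph H)" for i j
    by (simp add: in_skeleton_of_digraph)
  have "\<exists>i j. e = {i, j}" if "e \<in> skeleton (of_digraph K)" for e :: "'a set" and K
    using that by (auto simp: skeleton_def of_digraph_def)
  with eq show "skeleton (of_digraph G) = skeleton (of_digraph H)" by blast
next
  assume "skeleton (of_digraph G) = skeleton (of_digraph H)"
  then have "linked G i j \<longleftrightarrow> linked H i j" for i j
    by (simp flip: in_skeleton_of_digraph)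
  then show "linked G = linked H" by blast
qed

lemma v_structures_of_digraph:
  "(i, k, j) \<in> v_structures (of_digraph G) \<longleftrightarrow> unshielded_collider G i k j"
  by (auto simp: v_structures_def unshielded_collider_def adjacent_def in_skeleton_of_digraph)
    (auto simp: of_digraph_def)

lemma v_structures_of_digraph_eq_iff:
  "v_structures (of_digraph G) = v_structures (of_digraph H) \<longleftrightarrow>
   unshielded_collider G = unshielded_collider H"
proof -
  have "v_structures (of_digraph G) = {(i, k, j). unshielded_collider G i k j}" for G :: "('a \<times> 'a) set"
    using v_structures_of_digraph by fast
  then show ?thesis by (auto simp: set_eq_iff fun_eq_iff)
qed

subsection \<open>Reversal of a covered edge\<close>

definition reverse_arc :: "'v \<Rightarrow> 'v \<Rightarrow> ('v \<times> 'v) set \<Rightarrow> ('v \<times> 'v) set" where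
  "reverse_arc x y G = insert (y, x) (G - {(x, y)})"

definition covered :: "('v \<times> 'v) set \<Rightarrow> 'v \<Rightarrow> 'v \<Rightarrow> bool" where
  "covered G x y \<longleftrightarrow> (x, y) \<in> G \<and> (\<forall>z. (z, y) \<in> G \<longleftrightarrow> z = x \<or> (z, x) \<in> G)"

lemma covered_reverse_arc:
  assumes "acyclic G" "covered G x y"
  shows "covered (reverse_arc x y G) y x" "reverse_arc y x (reverse_arc x y G) = G"
proof -
  have xy: "(x, y) \<in> G" "(y, x) \<notin> G" "(x, x) \<notin> G" "(y, y) \<notin> G" "x \<noteq> y"
    using assms(2) acyclic_no_loop[OF assms(1)] acyclic_no_2cycle[OF assms(1)]
    unfolding covered_def by blast+
  then show "reverse_arc y x (reverse_arc x y G) = G" by (auto simp: reverse_arc_def)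
  show "covered (reverse_arc x y G) y x"
    using assms(2) xy by (auto simp: covered_def reverse_arc_def)
qed

text \<open>A second directed path from \<open>x\<close> to \<open>y\<close> would enter
  \<open>y\<close> through a parent other than \<open>x\<close>. By coveredness this is a parent of
  \<open>x\<close>, which closes a cycle in \<open>G\<close>.\<close>

lemma acyclic_reverse_arc:
  assumes "acyclic G" "covered G x y"
  shows "acyclic (reverse_arc x y G)"
proof -
  let ?r = "G - {(x, y)}"
  have "(x, y) \<notin> ?r\<^sup>*"
  proof
    assume "(x, y) \<in> ?r\<^sup>*"
    moreover have "x \<noteq> y" using assms acyclic_no_loop[of G] by (auto simp: covered_def)
    ultimately obtain w where w: "(x, w) \<in> ?r\<^sup>*" "(w, y) \<in> ?r" by (metis rtranclE)
    then have "(w, x) \<in> G" using assms(2) by (auto simp: covered_def)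
    moreover have "(x, w) \<in> G\<^sup>*" using w(1) by (metis Diff_subset rtrancl_mono subsetD)
    ultimately show False using assms(1) by (meson acyclic_def rtrancl_into_trancl1)
  qed
  then show ?thesis
    using assms(1) unfolding reverse_arc_def acyclic_insert by (meson Diff_subset acyclic_subset)
qed

text \<open>The other parents of \<open>x\<close> and of \<open>y\<close> are common to both, so
  every collider that uses the reversed edge is shielded, before and after.\<close>

lemma same_pattern_reverse_arc:
  assumes "acyclic G" "covered G x y"
  shows "same_pattern G (reverse_arc x y G)"
proof -
  have l: "linked (reverse_arc x y G) = linked G"
    using assms(2) by (auto simp: fun_eq_iff linked_def reverse_arc_def covered_def)
  have "unshielded_collider (reverse_arc x y G) i k j \<longleftrightarrow> unshielded_collider G i k j" for i k j
    using assms(2) unfolding unshielded_collider_def l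
    by (auto simp: linked_def reverse_arc_def covered_def)
  with l show ?thesis by (simp add: same_pattern_def fun_eq_iff)
qed

text \<open>
  Nodes other than \<open>x\<close> and \<open>y\<close> remain reachable with the same flag. At \<open>x\<close> and \<open>y\<close> it only
  matters whether the pair has been entered through a common parent (\<open>I\<close>) or through a child of
  \<open>x\<close> or of \<open>y\<close>.
\<close>

lemma d_reach_reverse_arc:
  fixes G :: "('v \<times> 'v) set" and C :: "'v set" and a b x y :: 'v and m :: bool
  assumes "acyclic G" "covered G x y"
  defines "R \<equiv> d_reach (reverse_arc x y G) C a"
  defines "I \<equiv> \<exists>p m. R p m \<and> p \<notin> C \<and> (p, x) \<in> G"
  defines "X \<equiv> R x False \<or> (y \<notin> C \<and> R y False) \<or> (y \<in> C \<and> I)"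
  assumes "d_reach G C a b m"
  shows "if b = x then (if m then I else X)
    else if b = y then (if m then I \<or> (x \<notin> C \<and> X) else R y False)
    else R b m"
  \<comment> \<open>The disjuncts of \<open>X\<close> mirror the ways in which a walk in
    \<open>G\<close> gets to \<open>x\<close> with flag \<open>False\<close>: by starting there or
    from a child other than \<open>y\<close>, from \<open>y\<close> left as a noncollider, and from
    \<open>y\<close> in \<open>C\<close> passed as a collider.\<close>
  using assms(6)
proof (induction rule: d_reach.induct)
  have xy: "(x, y) \<in> G" and cov: "\<And>z. (z, y) \<in> G \<longleftrightarrow> z = x \<or> (z, x) \<in> G"
    using assms(2) by (auto simp: covered_def)
  have ne: "x \<noteq> y" using xy acyclic_no_loop[OF assms(1)] by auto
  have nyx: "(y, x) \<notin> G" using xy acyclic_no_2cycle[OF assms(1)] by auto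
  have rev: "(u, v) \<in> reverse_arc x y G \<longleftrightarrow> (u, v) = (y, x) \<or> ((u, v) \<in> G \<and> (u, v) \<noteq> (x, y))"
    for u v by (auto simp: reverse_arc_def)
  have dn: "R c True" if "R b m" "b \<notin> C" "(b, c) \<in> G" "(b, c) \<noteq> (x, y)" for b c m
    using that d_reach.down[of "reverse_arc x y G" C a b m c] rev unfolding R_def by blast
  have upw: "R c False" if "R b m" "m \<longleftrightarrow> b \<in> C" "(c, b) \<in> G" "(c, b) \<noteq> (x, y)" for b c m
    using that d_reach.up[of "reverse_arc x y G" C a b m c] rev unfolding R_def by blast
  have dnyx: "R x True" if "R y m" "y \<notin> C" for m
    using that d_reach.down[of "reverse_arc x y G" C a y m x] rev unfolding R_def by blast
  have upxy: "R y False" if "R x False" "x \<notin> C"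
    using that d_reach.up[of "reverse_arc x y G" C a x False y] rev unfolding R_def by blast
  have Ix: "R x True" if I using that dn ne unfolding I_def by blast
  have Iy: "R y True" if I using that dn cov acyclic_no_loop[OF assms(1)] unfolding I_def by blast
  {
    case start
    show ?case using d_reach.start[of "reverse_arc x y G" C a] by (auto simp: R_def X_def)
  next
    case (down b m c)
    note IH = down.IH and bC = \<open>b \<notin> C\<close> and bc = \<open>(b, c) \<in> G\<close>
    consider "b = x" "c = y" | "b = x" "c \<noteq> y" "c \<noteq> x" | "b = y" "c \<noteq> y" "c \<noteq> x"
      | "b \<noteq> x" "b \<noteq> y"
      using bc nyx acyclic_no_loop[OF assms(1)] by metis
    then show ?case
    proof cases
      case 1
      then show ?thesis using IH bC ne by (auto split: if_splits)
    next
      case 2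
      then show ?thesis using IH bC bc dn[of x _ c] Ix dnyx by (auto simp: X_def split: if_splits)
    next
      case 3
      then show ?thesis using IH bC bc ne dn[of y _ c] Iy upxy by (auto simp: X_def split: if_splits)
    next
      case 4
      then have "R b m" using IH by simp
      then have "R c True" "c = x \<Longrightarrow> I" "c = y \<Longrightarrow> I"
        using dn[of b m c] 4 bC bc cov unfolding I_def by blast+
      then show ?thesis by simp
    qed
  next
    case (up b m c)
    note IH = up.IH and bC = \<open>m \<longleftrightarrow> b \<in> C\<close> and cb = \<open>(c, b) \<in> G\<close>
    consider "b = y" "c = x" | "b = x" "c \<noteq> y" "c \<noteq> x" "(c, x) \<in> G" "(c, y) \<in> G"
      | "b = y" "c \<noteq> y" "c \<noteq> x" "(c, x) \<in> G" "(c, y) \<in> G"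
      | "b \<noteq> x" "b \<noteq> y"
      using cb nyx cov acyclic_no_loop[OF assms(1)] by metis
    then show ?case
    proof cases
      case 1
      then show ?thesis using IH bC ne by (auto simp: X_def split: if_splits)
    next
      case 2
      then show ?thesis
        using IH bC upw[of x _ c] upw[of y _ c] Ix Iy by (auto simp: X_def split: if_splits)
    next
      case 3
      then show ?thesis
        using IH bC ne upw[of x _ c] upw[of y _ c] Ix Iy by (auto simp: X_def split: if_splits)
    next
      case 4
      then have "R b m" using IH by simp
      then have "R c False" using upw[of b m c] 4 bC cb by blast
      then show ?thesis by (auto simp: X_def)
    qed
  }
qed

lemma d_connected_reverse_arc_mono:
  assumes "acyclic G" "covered G x y" "d_connected G C a b"
  shows "d_connected (reverse_arc x y G) C a b"
proof -
  let ?R = "d_reach (reverse_arc x y G) C a"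
  obtain m where m: "d_reach G C a b m" using assms(3) unfolding d_connected_def ..
  have rev: "(u, v) \<in> reverse_arc x y G \<longleftrightarrow> (u, v) = (y, x) \<or> ((u, v) \<in> G \<and> (u, v) \<noteq> (x, y))"
    for u v by (auto simp: reverse_arc_def)
  have dnyx: "?R x True" if "?R y m" "y \<notin> C" for m
    using that d_reach.down[of "reverse_arc x y G" C a y m x] rev by blast
  have upxy: "?R y False" if "?R x False" "x \<notin> C"
    using that d_reach.up[of "reverse_arc x y G" C a x False y] rev by blast
  have I: "?R x True \<and> ?R y True" if "?R p m" "p \<notin> C" "(p, x) \<in> G" for p m
    using that d_reach.down[of "reverse_arc x y G" C a p m] rev assms(2) acyclic_no_loop[OF assms(1)]
    unfolding covered_def by blast
  show ?thesis
    using d_reach_reverse_arc[OF assms(1,2) m] dnyx upxy I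
    unfolding d_connected_def by (smt (verit, best))
qed

text \<open>The reversed edge is covered again and its reversal restores \<open>G\<close>, so
  monotonicity in one direction suffices.\<close>

lemma d_connected_reverse_arc:
  assumes "acyclic G" "covered G x y"
  shows "d_connected (reverse_arc x y G) = d_connected G"
proof (intro ext iffI)
  fix C a b
  assume "d_connected (reverse_arc x y G) C a b"
  from d_connected_reverse_arc_mono[OF acyclic_reverse_arc[OF assms] _ this]
  show "d_connected G C a b" using covered_reverse_arc[OF assms] by metis
qed (rule d_connected_reverse_arc_mono[OF assms])

text \<open>
  Chickering's choice of a covered edge: among the edges \<open>x \<rightarrow> y\<close> on which \<open>G\<close> and \<open>H\<close> disagree, take
  \<open>y\<close> minimal and then \<open>x\<close> maximal in the order of \<open>G\<close>.
\<close>

lemma exists_covered_difference: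
  fixes G H :: "('v::finite \<times> 'v) set"
  assumes G: "acyclic G" and H: "acyclic H" and pat: "same_pattern G H" and ne: "G \<noteq> H"
  obtains x y where "covered G x y" "(y, x) \<in> H"
proof -
  have link: "linked G i j \<longleftrightarrow> linked H i j" for i j using pat by (simp add: same_pattern_def)
  have coll: "unshielded_collider G i k j \<longleftrightarrow> unshielded_collider H i k j" for i k j
    using pat by (simp add: same_pattern_def)
  define D where "D = {(x, y). (x, y) \<in> G \<and> (y, x) \<in> H}"
  have GH: "(a, b) \<in> H" if "(a, b) \<in> G" "(a, b) \<notin> D" for a b
    using link[of a b] that by (auto simp: linked_def D_def)
  have D: "(a, b) \<in> G" "(b, a) \<in> H" if "(a, b) \<in> D" for a b using that by (auto simp: D_def)
  have "D \<noteq> {}"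
  proof
    assume "D = {}"
    then have "G \<subseteq> H" using GH by auto
    moreover have "H \<subseteq> G"
    proof
      fix e assume "e \<in> H"
      then show "e \<in> G" using link[of "fst e" "snd e"] \<open>G \<subseteq> H\<close> acyclic_no_2cycle[OF H]
        by (cases e) (auto simp: linked_def)
    qed
    ultimately show False using ne by simp
  qed
  then obtain x0 y0 where "(x0, y0) \<in> D" by auto
  have wf: "wf G" "wf (G\<inverse>)"
    using G finite_acyclic_wf[of G] finite_acyclic_wf_converse[of G] by auto
  obtain y where y: "y \<in> Range D" and ymin: "\<And>z. (z, y) \<in> G \<Longrightarrow> z \<notin> Range D"
    using wfE_min[OF wf(1) RangeI[OF \<open>(x0, y0) \<in> D\<close>]] by metis
  from y obtain x1 where "x1 \<in> {x. (x, y) \<in> D}" by auto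
  then obtain x where xD: "(x, y) \<in> D" and xmax: "\<And>z. (x, z) \<in> G \<Longrightarrow> (z, y) \<notin> D"
    using wfE_min[OF wf(2), of x1 "{x. (x, y) \<in> D}"] by (metis converse_iff mem_Collect_eq)
  note xy = D[OF xD]
  have "(z, y) \<in> G" if zx: "(z, x) \<in> G" for z
  proof (rule ccontr)
    assume "(z, y) \<notin> G"
    moreover have "(y, z) \<notin> G" using acyclic_no_3cycle[OF G zx xy(1)] .
    ultimately have "\<not> linked G z y" by (simp add: linked_def)
    have "(z, x) \<in> H" using GH[OF zx] ymin[OF xy(1)] by blast
    have "z \<noteq> y" using zx xy(1) acyclic_no_2cycle[OF G] by blast
    have "unshielded_collider H z x y"
      using \<open>(z, x) \<in> H\<close> xy(2) \<open>\<not> linked G z y\<close> link \<open>z \<noteq> y\<close> by (simp add: unshielded_collider_def)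
    then have "(y, x) \<in> G" using coll by (auto simp: unshielded_collider_def)
    then show False using xy(1) acyclic_no_2cycle[OF G] by blast
  qed
  moreover have "z = x \<or> (z, x) \<in> G" if zy: "(z, y) \<in> G" for z
  proof (rule ccontr)
    assume n: "\<not> (z = x \<or> (z, x) \<in> G)"
    show False
    proof (cases "linked G z x")
      case False
      then have "unshielded_collider G z y x" using n zy xy(1) by (simp add: unshielded_collider_def)
      then have "(x, y) \<in> H" using coll by (auto simp: unshielded_collider_def)
      then show False using xy(2) acyclic_no_2cycle[OF H] by blast
    next
      case True
      then have xz: "(x, z) \<in> G" using n by (auto simp: linked_def)
      then have "(z, y) \<in> H" using GH[OF zy] xmax by blast
      \<comment> \<open>\<open>H\<close> contains \<open>z -> y -> x\<close>, so acyclicity forces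
        \<open>z -> x\<close>. This is a difference with head \<open>z\<close>, a parent of
        \<open>y\<close>, against the minimality of \<open>y\<close>.\<close>
      have "(z, x) \<in> H"
        using link[of x z] xz acyclic_no_3cycle[OF H \<open>(z, y) \<in> H\<close> xy(2)] by (auto simp: linked_def)
      then have "z \<in> Range D" using xz by (auto simp: D_def)
      then show False using ymin[OF zy] by blast
    qed
  qed
  ultimately have "covered G x y" using xy(1) unfolding covered_def by blast
  then show thesis using that xy(2) by blast
qed

text \<open>Each reversal brings one more arc into agreement with \<open>H\<close> and spoils
  none.\<close>

lemma same_pattern_imp_d_connected_eq:
  fixes G H :: "('v::finite \<times> 'v) set"
  assumes "acyclic G" "acyclic H" "same_pattern G H"
  shows "d_connected G = d_connected H"
  using assms
proof (induction "card (G - H)" arbitrary: G rule: less_induct)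
  case less
  show ?case
  proof (cases "G = H")
    case False
    obtain x y where xy: "covered G x y" "(y, x) \<in> H"
      using exists_covered_difference[OF less.prems False] .
    let ?G = "reverse_arc x y G"
    have "(x, y) \<in> G - H"
      using xy acyclic_no_2cycle[OF less.prems(2)] unfolding covered_def by blast
    moreover have "?G - H \<subseteq> G - H - {(x, y)}" using xy(2) by (auto simp: reverse_arc_def)
    ultimately have "card (?G - H) < card (G - H)"
      by (metis (no_types, lifting) card_Diff1_less card_mono finite order_le_less_trans)
    moreover have "same_pattern ?G H"
      using same_pattern_reverse_arc[OF less.prems(1) xy(1)] less.prems(3)
      by (meson same_pattern_sym same_pattern_trans)
    ultimately have "d_connected ?G = d_connected H"
      using less.hyps acyclic_reverse_arc[OF less.prems(1) xy(1)] less.prems(2) by blast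
    then show ?thesis using d_connected_reverse_arc[OF less.prems(1) xy(1)] by simp
  qed simp
qed

lemma same_pattern_imp_markov_equivalent:
  fixes G H :: "('v::finite \<times> 'v) set"
  assumes "acyclic G" "acyclic H" "same_pattern G H"
  shows "markov_equivalent G H"
  using same_pattern_imp_d_connected_eq[OF assms] assms(1,2)
  by (simp add: markov_equivalent_def d_separated_iff_not_d_connected)

subsection \<open>d-separation determines the pattern\<close>

text \<open>Given its parents, a walk from \<open>i\<close> is trapped. A step up ends in a parent,
  which is conditioned on and can be left neither way; steps down stay among the descendants, none
  of which is a parent of \<open>i\<close>, so no collider opens.\<close>

lemma not_d_connected_parents:
  assumes "acyclic G" "\<not> linked G i j" "i \<noteq> j" "(i, j) \<notin> G\<^sup>+"
  shows "\<not> d_connected G (parents G i) i j"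
proof -
  have "(b = i \<and> \<not> m) \<or> (m \<and> (i, b) \<in> G\<^sup>+) \<or> (\<not> m \<and> b \<in> parents G i)"
    if "d_reach G (parents G i) i b m" for b m
    using that
  proof (induction rule: d_reach.induct)
    case (down b m c)
    then show ?case by (auto intro: trancl_into_trancl)
  next
    case (up b m c)
    then show ?case using assms(1) by (auto simp: parents_def acyclic_def intro: trancl_into_trancl)
  qed simp
  then show ?thesis
    using assms(2-4) by (fastforce simp: d_connected_def parents_def linked_def)
qed

lemma d_connected_linked:
  assumes "linked G i j" "i \<notin> C"
  shows "d_connected G C i j"
  using assms d_reach.start[of G C i] d_reach.down[of G C i i False j] d_reach.up[of G C i i False j]
  unfolding d_connected_def linked_def by blast

text \<open>The two orders of \<open>i\<close> and \<open>j\<close> are both needed since the separating set consists of the parents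
  of a node that is not an ancestor of the other one.\<close>

lemma separating_set_exists:
  assumes "acyclic G" "\<not> linked G i j" "i \<noteq> j"
  shows "(\<not> d_connected G (parents G i) i j \<and> j \<notin> parents G i \<and> i \<notin> parents G i) \<or>
    (\<not> d_connected G (parents G j) j i \<and> i \<notin> parents G j \<and> j \<notin> parents G j)"
proof (cases "(i, j) \<in> G\<^sup>+")
  case True
  then have "(j, i) \<notin> G\<^sup>+" using assms(1) by (meson acyclic_def trancl_trans)
  then show ?thesis
    using not_d_connected_parents[OF assms(1), of j i] assms acyclic_no_loop[OF assms(1)]
    by (auto simp: linked_def parents_def)
next
  case False
  then show ?thesis
    using not_d_connected_parents[OF assms(1), of i j] assms acyclic_no_loop[OF assms(1)]
    by (auto simp: linked_def parents_def)
qed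

text \<open>In every other case the two-edge walk through \<open>k\<close> would connect
  \<open>i\<close> to \<open>j\<close> given \<open>S\<close>.\<close>

lemma unshielded_collider_iff_not_in_separating_set:
  assumes "acyclic G" "linked G i k" "linked G k j" "\<not> linked G i j" "i \<noteq> j"
    "\<not> d_connected G S i j" "i \<notin> S"
  shows "unshielded_collider G i k j \<longleftrightarrow> k \<notin> S"
proof -
  let ?R = "d_reach G S i"
  have s: "?R i False" by (rule d_reach.start)
  have n: "\<not> ?R j m" for m using assms(6) by (auto simp: d_connected_def)
  have dn: "?R c True" if "?R b m" "b \<notin> S" "(b, c) \<in> G" for b c m
    using that by (rule d_reach.down)
  have upw: "?R c False" if "?R b m" "(c, b) \<in> G" "m \<longleftrightarrow> b \<in> S" for b c m
    using that by (rule d_reach.up)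
  show ?thesis
  proof
    assume "unshielded_collider G i k j"
    then have "(i, k) \<in> G" "(j, k) \<in> G" by (auto simp: unshielded_collider_def)
    then show "k \<notin> S" using dn[OF s assms(7)] upw[of k True j] n by blast
  next
    assume k: "k \<notin> S"
    show "unshielded_collider G i k j"
    proof (rule ccontr)
      assume "\<not> unshielded_collider G i k j"
      then have "(k, i) \<in> G \<or> (i, k) \<in> G \<and> (k, j) \<in> G"
        using assms(2-5) by (auto simp: unshielded_collider_def linked_def)
      then show False
      proof
        assume "(k, i) \<in> G"
        then have "?R k False" using upw[OF s] assms(7) by blast
        then show False using dn[of k False j] upw[of k False j] k n assms(3) by (auto simp: linked_def)
      next
        assume "(i, k) \<in> G \<and> (k, j) \<in> G"
        then show False using dn[OF s assms(7), of k] dn[of k True j] k n by blast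
      qed
    qed
  qed
qed

lemma markov_equivalent_d_connected:
  assumes "acyclic G" "acyclic H" "markov_equivalent G H" "i \<noteq> j" "i \<notin> C" "j \<notin> C"
  shows "d_connected G C i j \<longleftrightarrow> d_connected H C i j"
  using assms(3)[unfolded markov_equivalent_def, rule_format, of "{i}" "{j}" C] assms
  by (simp add: d_separated_iff_not_d_connected)

lemma markov_equivalent_sym: "markov_equivalent G H \<Longrightarrow> markov_equivalent H G"
  by (simp add: markov_equivalent_def)

text \<open>The pattern can be read off from d-separations: two nodes are adjacent iff no set
  separates them, and the middle node of an unshielded triple is a collider iff a separating set of
  the outer nodes omits it.\<close>

lemma markov_equivalent_imp_same_pattern:
  assumes "acyclic G" "acyclic H" "markov_equivalent G H"
  shows "same_pattern G H"
proof -
  have link: "linked K i j" if "acyclic K" "acyclic L" "markov_equivalent K L" "linked L i j"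
    for K L :: "('a \<times> 'a) set" and i j
  proof (rule ccontr)
    assume n: "\<not> linked K i j"
    have ij: "i \<noteq> j" using that(4) acyclic_no_loop[OF that(2)] by (auto simp: linked_def)
    have "\<And>C. i \<notin> C \<Longrightarrow> j \<notin> C \<Longrightarrow> d_connected K C i j"
      "\<And>C. i \<notin> C \<Longrightarrow> j \<notin> C \<Longrightarrow> d_connected K C j i"
      using markov_equivalent_d_connected[OF that(1-3)] d_connected_linked ij that(4) linked_sym
      by metis+
    then show False using separating_set_exists[OF that(1) n ij] by blast
  qed
  have L: "linked G = linked H"
    using link[OF assms] link[OF assms(2,1) markov_equivalent_sym[OF assms(3)]] by blast
  have "unshielded_collider G i k j \<longleftrightarrow> unshielded_collider H i k j" for i k j
  proof (cases "linked G i k \<and> linked G k j \<and> \<not> linked G i j \<and> i \<noteq> j")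
    case False
    then show ?thesis using L linked_def unfolding unshielded_collider_def by metis
  next
    case True
    have *: "unshielded_collider G i k j \<longleftrightarrow> unshielded_collider H i k j"
      if "linked G i k \<and> linked G k j \<and> \<not> linked G i j \<and> i \<noteq> j"
        "\<not> d_connected G S i j" "i \<notin> S" "j \<notin> S" for i j S
      using that unshielded_collider_iff_not_in_separating_set[of G i k j S]
        unshielded_collider_iff_not_in_separating_set[of H i k j S] assms
        markov_equivalent_d_connected[OF assms, of i j S] L by metis
    have swap: "unshielded_collider K i k j \<longleftrightarrow> unshielded_collider K j k i"
      for K :: "('a \<times> 'a) set" using linked_def unfolding unshielded_collider_def by metis
    from separating_set_exists[OF assms(1), of i j] True
    show ?thesis using *[of i j] *[of j i] swap linked_sym by metis
  qed
  with L show ?thesis by (simp add: same_pattern_def fun_eq_iff)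
qed

section \<open>Chordal graphs\<close>

text \<open>Elimination orderings are listed in the order of elimination: each node is simplicial in the
  graph on the nodes that follow it.\<close>

fun elim_ordering :: "('v \<Rightarrow> 'v \<Rightarrow> bool) \<Rightarrow> 'v list \<Rightarrow> bool" where
  "elim_ordering U [] = True"
| "elim_ordering U (v # xs) \<longleftrightarrow>
     v \<notin> set xs \<and> pairwise U {a \<in> set xs. U v a} \<and> elim_ordering U xs"

lemma elim_ordering_distinct: "elim_ordering U xs \<Longrightarrow> distinct xs"
  by (induction xs) auto

lemma elim_ordering_clique:
  "distinct ks \<Longrightarrow> pairwise U (set ks) \<Longrightarrow> elim_ordering U ks"
  by (induction ks) (auto simp: pairwise_def)

lemma elim_ordering_replace_tail:
  assumes "elim_ordering U (ys @ ks)" "elim_ordering U ks'" "set ks' = insert v (set ks)"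
    "\<forall>y\<in>set ys. \<not> U y v" "v \<notin> set ys"
  shows "elim_ordering U (ys @ ks')"
  using assms
proof (induction ys)
  case (Cons y ys)
  have "{a \<in> set (ys @ ks'). U y a} \<subseteq> {a \<in> set (ys @ ks). U y a}"
    using Cons.prems(3,4) by auto
  then have "pairwise U {a \<in> set (ys @ ks'). U y a}"
    using Cons.prems(1) by (auto intro: pairwise_subset)
  then show ?case using Cons by auto
qed simp

text \<open>
  If the node \<open>v\<close> to be eliminated first belongs to \<open>K\<close>, one eliminates the neighbourhood of \<open>v\<close> last and inserts \<open>v\<close> there.
\<close>

lemma elim_ordering_ending_with_clique:
  assumes sym: "\<And>a b. U a b \<Longrightarrow> U b a"
    and "elim_ordering U xs" "K \<subseteq> set xs" "pairwise U K"
  shows "\<exists>ys ks. elim_ordering U (ys @ ks) \<and> set ks = K \<and> set (ys @ ks) = set xs"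
  using assms(2-4)
proof (induction xs arbitrary: K)
  case Nil
  then show ?case by (intro exI[of _ "[]"]) simp
next
  case (Cons v xs)
  show ?case
  proof (cases "v \<in> K")
    case False
    then have "K \<subseteq> set xs" using Cons.prems(2) by auto
    then obtain ys ks where "elim_ordering U (ys @ ks)" "set ks = K" "set (ys @ ks) = set xs"
      using Cons.IH[of K] Cons.prems by auto
    then show ?thesis using Cons.prems(1)
      by (intro exI[of _ "v # ys"] exI[of _ ks]) (simp flip: set_append)
  next
    case True
    let ?N = "{a \<in> set xs. U v a}"
    obtain ys ks where ks: "elim_ordering U (ys @ ks)" "set ks = ?N" "set (ys @ ks) = set xs"
      using Cons.IH[of ?N] Cons.prems by auto
    have "K - {v} \<subseteq> ?N"
      using Cons.prems(2,3) True by (auto simp: pairwise_def)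
    obtain ks1 where ks1: "distinct ks1" "set ks1 = ?N - K"
      by (metis (no_types, lifting) List.finite_set finite_Diff finite_distinct_list ks(2))
    have "finite (K - {v})" using \<open>K - {v} \<subseteq> ?N\<close> finite_subset by fastforce
    then obtain ks2 where ks2: "distinct ks2" "set ks2 = K - {v}"
      by (metis finite_distinct_list)
    have v: "v \<notin> set xs" using Cons.prems(1) by simp
    \<comment> \<open>Together with \<open>v\<close> its neighbourhood is a clique, so its nodes may
      be listed in any order; those of \<open>K\<close> are put at the end.\<close>
    let ?ks = "ks1 @ v # ks2"
    have set: "set ?ks = insert v (set ks)"
      using ks(2) ks1(2) ks2(2) \<open>K - {v} \<subseteq> ?N\<close> by auto
    have "pairwise U (insert v ?N)"
      using Cons.prems(1) sym by (auto simp: pairwise_insert)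
    then have "elim_ordering U ?ks"
      using set ks(2) v ks1 ks2 by (intro elim_ordering_clique) auto
    moreover have "\<forall>y\<in>set ys. \<not> U y v"
      using elim_ordering_distinct[OF ks(1)] ks(2,3) sym by (auto simp: set_eq_iff)
    moreover have "v \<notin> set ys" using ks(3) v by auto
    ultimately have "elim_ordering U (ys @ ?ks)"
      using elim_ordering_replace_tail[OF ks(1)] set by blast
    moreover have "set (v # ks2) = K" using ks2(2) True by auto
    moreover have "set (ys @ ?ks) = set (v # xs)" using set ks(3) by auto
    ultimately show ?thesis
      by (intro exI[of _ "ys @ ks1"] exI[of _ "v # ks2"]) simp
  qed
qed

text \<open>The rank counts positions from the end of the list. Orienting edges from smaller to
  larger rank thus gives each node a clique of parents and makes the node eliminated last a
  source.\<close>

lemma elim_ordering_rank: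
  assumes "elim_ordering U xs"
  shows "\<exists>f :: 'v \<Rightarrow> nat. inj_on f (set xs) \<and> (\<forall>a\<in>set xs. f a < length xs) \<and>
    (xs \<noteq> [] \<longrightarrow> f (last xs) = 0) \<and>
    (\<forall>c\<in>set xs. pairwise U {a \<in> set xs. U c a \<and> f a < f c})"
  using assms
proof (induction xs)
  case (Cons v xs)
  have "elim_ordering U xs" using Cons.prems by simp
  from Cons.IH[OF this] obtain f :: "'v \<Rightarrow> nat" where f: "inj_on f (set xs)" "\<forall>a\<in>set xs. f a < length xs"
    "xs \<noteq> [] \<longrightarrow> f (last xs) = 0" "\<forall>c\<in>set xs. pairwise U {a \<in> set xs. U c a \<and> f a < f c}"
    by blast
  let ?f = "f(v := length xs)"
  have v: "v \<notin> set xs" "pairwise U {a \<in> set xs. U v a}" using Cons.prems by auto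
  have 1: "inj_on ?f (set (v # xs))"
    using f(1,2) v(1) unfolding inj_on_def by (metis fun_upd_apply nat_neq_iff set_ConsD)
  have 2: "\<forall>a\<in>set (v # xs). ?f a < length (v # xs)" using f(2) by (simp add: less_SucI)
  have 3: "?f (last (v # xs)) = 0"
    using f(3) v(1) last_in_set[of xs] by (cases "xs = []") (simp, metis fun_upd_other last_ConsR)
  have 4: "pairwise U {a \<in> set (v # xs). U c a \<and> ?f a < ?f c}" if "c \<in> set (v # xs)" for c
  proof (cases "c = v")
    case True
    then have "{a \<in> set (v # xs). U c a \<and> ?f a < ?f c} \<subseteq> {a \<in> set xs. U v a}" by auto
    then show ?thesis using v(2) pairwise_subset by blast
  next
    case False
    then have "c \<in> set xs" "f c < length xs" using that f(2) by auto
    then have "{a \<in> set (v # xs). U c a \<and> ?f a < ?f c} \<subseteq> {a \<in> set xs. U c a \<and> f a < f c}"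
      using False by (auto split: if_splits)
    then show ?thesis using f(4) \<open>c \<in> set xs\<close> pairwise_subset by blast
  qed
  show ?case
    by (rule exI[of _ ?f]) (use 1 2 3 4 in blast)
qed simp

text \<open>A sink of \<open>H\<close> within the remaining nodes is simplicial there: its remaining
  \<open>U\<close>-neighbours are all parents, and the last assumption joins them.\<close>

lemma elim_ordering_of_dag:
  fixes H :: "('v::finite \<times> 'v) set"
  assumes "acyclic H" "\<And>a b. U a b \<Longrightarrow> linked H a b"
    "\<And>a b c. U c a \<Longrightarrow> U c b \<Longrightarrow> (a, c) \<in> H \<Longrightarrow> (b, c) \<in> H \<Longrightarrow> a \<noteq> b \<Longrightarrow> U a b"
  shows "\<exists>xs. set xs = S \<and> elim_ordering U xs"
proof (induction "card S" arbitrary: S)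
  case 0
  then show ?case by (intro exI[of _ "[]"]) simp
next
  case (Suc n)
  then obtain s where "s \<in> S" by fastforce
  have "wf (H\<inverse>)" using assms(1) by (simp add: finite_acyclic_wf_converse)
  then obtain v where v: "v \<in> S" "\<And>w. (v, w) \<in> H \<Longrightarrow> w \<notin> S"
    using wfE_min[OF _ \<open>s \<in> S\<close>] by (metis converse_iff)
  obtain xs where xs: "set xs = S - {v}" "elim_ordering U xs"
    using Suc v(1) by (metis Suc_inject card_Suc_Diff1 finite)
  have into: "(a, v) \<in> H" if "a \<in> S" "U v a" for a
    using assms(2)[OF that(2)] v(2) that(1) by (auto simp: linked_def)
  have "pairwise U {a \<in> set xs. U v a}"
    using assms(3) into xs(1) by (auto simp: pairwise_def)
  then show ?case using xs v(1) by (intro exI[of _ "v # xs"]) auto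
qed

section \<open>Meek's orientation rules\<close>

text \<open>\<open>G\<close> is a partially directed graph that arises from the pattern of the DAG \<open>H\<close> by sound
  orientations.\<close>

definition orients_pattern :: "('v \<times> 'v) set \<Rightarrow> 'v pdag \<Rightarrow> bool" where
  "orients_pattern H G \<longleftrightarrow>
     skeleton G = skeleton (of_digraph H) \<and> arcs G \<subseteq> H \<and>
     (\<forall>(i, j) \<in> arcs G. {i, j} \<notin> undirected G) \<and>
     (\<forall>i k j. unshielded_collider H i k j \<longrightarrow> (i, k) \<in> arcs G)"

lemma orients_patternD:
  assumes "orients_pattern H G"
  shows "adjacent G i j \<longleftrightarrow> linked H i j"
    and "linked H i j \<longleftrightarrow> {i, j} \<in> undirected G \<or> (i, j) \<in> arcs G \<or> (j, i) \<in> arcs G"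
    and "(i, j) \<in> arcs G \<Longrightarrow> (i, j) \<in> H"
    and "(i, j) \<in> arcs G \<Longrightarrow> {i, j} \<notin> undirected G"
    and "(i, j) \<in> arcs G \<Longrightarrow> {j, i} \<notin> undirected G"
    and "unshielded_collider H i k j \<Longrightarrow> (i, k) \<in> arcs G"
proof -
  have "{i, j} \<in> skeleton G \<longleftrightarrow> {i, j} \<in> undirected G \<or> (i, j) \<in> arcs G \<or> (j, i) \<in> arcs G"
    by (auto simp: skeleton_def doubleton_eq_iff)
  then show "linked H i j \<longleftrightarrow> {i, j} \<in> undirected G \<or> (i, j) \<in> arcs G \<or> (j, i) \<in> arcs G"
    using assms in_skeleton_of_digraph unfolding orients_pattern_def by metis
  show "adjacent G i j \<longleftrightarrow> linked H i j"
    using assms in_skeleton_of_digraph unfolding orients_pattern_def adjacent_def by metis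
  show "unshielded_collider H i k j \<Longrightarrow> (i, k) \<in> arcs G"
    using assms unfolding orients_pattern_def by blast
qed (use assms in \<open>auto simp: orients_pattern_def insert_commute\<close>)

text \<open>
  The reason for which one of the rules orients \<open>a \<rightarrow> b\<close>, in a form that persists under further
  orientations. The last conjunct for rule R3 holds since otherwise \<open>k \<rightarrow> a \<leftarrow> l\<close> would have been
  oriented from the start.
\<close>

definition justified :: "('v \<times> 'v) set \<Rightarrow> 'v pdag \<Rightarrow> 'v \<Rightarrow> 'v \<Rightarrow> bool" where
  "justified H G a b \<longleftrightarrow>
     (\<exists>d. unshielded_collider H a b d) \<or>
     (\<exists>d. (d, a) \<in> arcs G \<and> d \<noteq> b \<and> \<not> linked H d b) \<or>
     (\<exists>d. (a, d) \<in> arcs G \<and> (d, b) \<in> arcs G) \<or>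
     (\<exists>k l. (k, b) \<in> arcs G \<and> (l, b) \<in> arcs G \<and> k \<noteq> l \<and> \<not> linked H k l \<and>
        linked H a k \<and> linked H a l \<and> \<not> ((k, a) \<in> H \<and> (l, a) \<in> H)) \<or>
     (\<exists>k l. (k, l) \<in> arcs G \<and> (l, b) \<in> arcs G \<and> linked H a k \<and> linked H a l \<and>
        k \<noteq> b \<and> \<not> linked H k b)"

section \<open>Soundness of the rules\<close>

lemma justified_mono: "justified H G a b \<Longrightarrow> arcs G \<subseteq> arcs G' \<Longrightarrow> justified H G' a b"
  unfolding justified_def by (elim disjE) (meson subsetD)+

text \<open>The opposite orientation would close a directed cycle in \<open>H\<close> or put an
  unshielded collider on an undirected edge, although all unshielded colliders of \<open>H\<close>
  are already oriented.\<close>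

lemma meek_step_orient:
  assumes "meek_step G G'" "acyclic H" "orients_pattern H G"
  obtains a b where "G' = orient a b G" "{a, b} \<in> undirected G" "(a, b) \<in> H" "justified H G a b"
proof -
  note d = orients_patternD[OF assms(3)]
  note n2 = acyclic_no_2cycle[OF assms(2)] and n3 = acyclic_no_3cycle[OF assms(2)]
  have und: "(a, b) \<in> H \<or> (b, a) \<in> H" if "{a, b} \<in> undirected G" for a b
    using d(2)[of a b] that by (auto simp: linked_def)
  have nocoll: "\<not> unshielded_collider H k i l" if "{i, k} \<in> undirected G" for i k l
    using d(5,6) that by blast
  from assms(1) show thesis
  proof cases
    case (R1 i j k)
    have "(j, k) \<in> H"
    proof (rule ccontr)
      assume "(j, k) \<notin> H"
      then have "unshielded_collider H k j i"
        using R1 und[of j k] d(1)[of i k] d(3)[of i j] linked_sym[of H k i]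
        unfolding unshielded_collider_def by blast
      then show False using nocoll R1 by blast
    qed
    moreover have "justified H G j k" using R1 d(1) unfolding justified_def by blast
    ultimately show thesis using that R1 by blast
  next
    case (R2 i j k)
    then have "(i, k) \<in> H" using und n3 d(3) by blast
    moreover have "justified H G i k" using R2 unfolding justified_def by blast
    ultimately show thesis using that R2 by blast
  next
    case (R3 i j k l)
    have kl: "\<not> ((k, i) \<in> H \<and> (l, i) \<in> H)"
      using nocoll[of i k l] R3 d(1) unfolding unshielded_collider_def by blast
    have "(i, j) \<in> H"
    proof (rule ccontr)
      assume "(i, j) \<notin> H"
      then have "(j, i) \<in> H" using und R3 by blast
      then have "(k, i) \<in> H" "(l, i) \<in> H" using R3 und[of i k] und[of i l] n3 d(3) by blast+
      with kl show False by simp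
    qed
    moreover have "linked H i k" "linked H i l" "\<not> linked H k l" using R3 d(1,2) by simp_all
    then have "justified H G i j" using R3(5-7) kl unfolding justified_def by metis
    ultimately show thesis using that R3 by blast
  next
    case (R4 i j k l)
    have "(i, j) \<in> H"
    proof (rule ccontr)
      assume "(i, j) \<notin> H"
      then have ji: "(j, i) \<in> H" using und R4 by blast
      have "(i, l) \<notin> H" using n3[OF d(3)[OF R4(5)] ji] .
      then have "(l, i) \<in> H" using R4(6) d(1)[of i l] unfolding linked_def by blast
      then have "(i, k) \<notin> H" using n3[OF d(3)[OF R4(4)]] by blast
      then have "(k, i) \<in> H" using und[OF R4(3)] by blast
      then have "unshielded_collider H k i j"
        using ji R4(7,8) d(1) unfolding unshielded_collider_def by blast
      then show False using nocoll[OF R4(3)] by blast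
    qed
    moreover have "linked H i k" "linked H i l" "\<not> linked H k j" using R4 d(1,2) by simp_all
    then have "justified H G i j" using R4(4,5,7) unfolding justified_def by metis
    ultimately show thesis using that R4 by blast
  qed
qed

lemma skeleton_orient: "{a, b} \<in> undirected G \<Longrightarrow> skeleton (orient a b G) = skeleton G"
  by (auto simp: skeleton_def orient_def)

lemma skeleton_meek_step: "meek_step G G' \<Longrightarrow> skeleton G' = skeleton G"
  by (erule meek_step.cases) (auto simp: skeleton_orient)

lemma skeleton_meek_steps: "meek_step\<^sup>*\<^sup>* G G' \<Longrightarrow> skeleton G' = skeleton G"
  by (induction rule: rtranclp_induct) (auto simp: skeleton_meek_step)

lemma meek_steps_sound:
  assumes "meek_step\<^sup>*\<^sup>* G G'" "acyclic H" "orients_pattern H G" "\<forall>(a, b) \<in> arcs G. justified H G a b"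
  shows "orients_pattern H G' \<and> (\<forall>(a, b) \<in> arcs G'. justified H G' a b)"
  using assms(1)
proof (induction rule: rtranclp_induct)
  case base
  then show ?case using assms(3,4) by simp
next
  case (step G1 G2)
  obtain a b where ab: "G2 = orient a b G1" "{a, b} \<in> undirected G1" "(a, b) \<in> H" "justified H G1 a b"
    using meek_step_orient[OF step.hyps(2) assms(2)] step.IH by blast
  have arcs: "arcs G2 = insert (a, b) (arcs G1)" using ab(1) by (simp add: orient_def)
  have "orients_pattern H G2"
    using step.IH ab skeleton_orient[OF ab(2)] unfolding orients_pattern_def
    by (auto simp: orient_def)
  moreover have "\<forall>(c, d) \<in> arcs G2. justified H G2 c d"
  proof (clarify)
    fix c d assume "(c, d) \<in> arcs G2"
    then have "justified H G1 c d" using step.IH ab(4) unfolding arcs by fast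
    then show "justified H G2 c d" using arcs by (rule_tac justified_mono) auto
  qed
  ultimately show ?case by simp
qed

section \<open>Completeness of the rules\<close>

locale meek_closed =
  fixes H :: "('v::finite \<times> 'v) set" and G :: "'v pdag"
  assumes acyclic: "acyclic H"
    and pattern: "orients_pattern H G"
    and justified: "(a, b) \<in> arcs G \<Longrightarrow> justified H G a b"
    and closed: "\<not> meek_step G G'"
begin

abbreviation U where "U i j \<equiv> {i, j} \<in> undirected G"

lemmas adj = orients_patternD(1)[OF pattern]
  and link = orients_patternD(2)[OF pattern]
  and arc = orients_patternD(3)[OF pattern]
  and arc_not_U = orients_patternD(4,5)[OF pattern]
  and coll = orients_patternD(6)[OF pattern]

lemma U_sym: "U i j \<Longrightarrow> U j i"
  by (simp add: insert_commute)

lemma rule1: "(i, j) \<in> arcs G \<Longrightarrow> U j k \<Longrightarrow> linked H i k"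
  using meek_step.R1[of i j G k] closed adj arc_not_U by blast

lemma rule2: "(i, j) \<in> arcs G \<Longrightarrow> (j, k) \<in> arcs G \<Longrightarrow> \<not> U i k"
  using meek_step.R2[of i j G k] closed by blast

lemma rule3: "U i j \<Longrightarrow> U i k \<Longrightarrow> U i l \<Longrightarrow> (k, j) \<in> arcs G \<Longrightarrow> (l, j) \<in> arcs G \<Longrightarrow> k \<noteq> l
    \<Longrightarrow> linked H k l"
  using meek_step.R3[of i j G k l] closed adj by blast

text \<open>R1 makes \<open>a\<close> and \<open>c\<close> adjacent, and R2 excludes
  \<open>c -> a\<close>.\<close>

lemma arc_U_cases:
  assumes "(a, b) \<in> arcs G" "U b c"
  shows "(a, c) \<in> arcs G \<or> U a c"
  using rule1[OF assms] rule2[of c a b] assms U_sym link by blast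

text \<open>If \<open>a - c\<close> were undirected, R1 would exclude \<open>d -> c\<close> and R3
  would exclude \<open>d - c\<close>.\<close>

lemma collider_U:
  assumes "unshielded_collider H a b d" "U b c"
  shows "(a, c) \<in> arcs G"
proof (rule ccontr)
  assume n: "(a, c) \<notin> arcs G"
  have ad: "a \<noteq> d" "\<not> linked H a d" "\<not> linked H d a"
    using assms(1) linked_sym unfolding unshielded_collider_def by metis+
  have ab: "(a, b) \<in> arcs G" "(d, b) \<in> arcs G"
    using assms(1) coll ad linked_sym unfolding unshielded_collider_def by metis+
  have ac: "U a c" using arc_U_cases[OF ab(1) assms(2)] n by simp
  from arc_U_cases[OF ab(2) assms(2)] show False
  proof
    assume "(d, c) \<in> arcs G"
    then show False using rule1[of d c a] ac U_sym ad by blast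
  next
    assume "U d c"
    then show False using rule3[of c b a d] ac assms(2) ab ad U_sym by blast
  qed
qed

text \<open>The key lemma of Meek's completeness proof.\<close>

lemma arc_U_arc: "(a, b) \<in> arcs G \<Longrightarrow> U b c \<Longrightarrow> (a, c) \<in> arcs G"
proof (induction b arbitrary: a c rule: wf_induct_rule[OF finite_acyclic_wf[OF finite acyclic]])
  case (1 b)
  note ab = 1(2) and bc = 1(3)
  have IH: "(x, z) \<in> arcs G" if "(y, b) \<in> arcs G" "(x, y) \<in> arcs G" "U y z" for x y z
    using 1(1) arc that by blast
  show ?case
  proof (rule ccontr)
    assume n: "(a, c) \<notin> arcs G"
    then have ac: "U a c" using arc_U_cases[OF ab bc] by simp
    \<comment> \<open>The cause of \<open>a -> b\<close> is carried across the undirected edges of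
      the triangle \<open>a -> b\<close>, \<open>b - c\<close>, \<open>c - a\<close>. The induction
      hypothesis covers arcs into parents of \<open>b\<close>.\<close>
    from justified[OF ab] consider
        (V) d where "unshielded_collider H a b d"
      | (R1) d where "(d, a) \<in> arcs G" "d \<noteq> b" "\<not> linked H d b"
      | (R2) d where "(a, d) \<in> arcs G" "(d, b) \<in> arcs G"
      | (R3) k l where "(k, b) \<in> arcs G" "(l, b) \<in> arcs G" "k \<noteq> l" "\<not> linked H k l"
          "linked H a k" "linked H a l" "\<not> ((k, a) \<in> H \<and> (l, a) \<in> H)"
      | (R4) k l where "(k, l) \<in> arcs G" "(l, b) \<in> arcs G" "linked H a k" "linked H a l"
          "k \<noteq> b" "\<not> linked H k b"
      unfolding justified_def by blast
    then show False
    proof cases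
      case V
      then show False using collider_U bc n by blast
    next
      case R1
      have "(d, c) \<in> arcs G" using IH[OF ab R1(1) ac] .
      then show False using rule1[of d c b] bc U_sym R1(3) by blast
    next
      case R2
      from arc_U_cases[OF R2(2) bc] show False
      proof
        assume "(d, c) \<in> arcs G"
        then show False using rule2[OF R2(1)] ac by blast
      next
        assume "U d c"
        then show False using IH[OF R2(2) R2(1)] n by blast
      qed
    next
      case R3
      \<comment> \<open>The collider moves along \<open>b - c\<close> and then along
        \<open>c - a\<close>, so both \<open>k\<close> and \<open>l\<close> point into
        \<open>a\<close>, which the last conjunct of the cause forbids.\<close>
      then have "unshielded_collider H k b l" "unshielded_collider H l b k"
        using arc linked_sym unfolding unshielded_collider_def by metis+
      then have kc: "(k, c) \<in> arcs G" "(l, c) \<in> arcs G" using collider_U bc by blast+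
      then have "unshielded_collider H k c l" "unshielded_collider H l c k"
        using arc R3(3,4) linked_sym unfolding unshielded_collider_def by metis+
      then have "(k, a) \<in> arcs G" "(l, a) \<in> arcs G" using collider_U ac U_sym by blast+
      then show False using R3(7) arc by blast
    next
      case R4
      \<comment> \<open>The contradiction sought is always \<open>k -> c\<close>: R1 excludes it
        because \<open>c - b\<close> is undirected while \<open>k\<close> and \<open>b\<close> are
        not linked.\<close>
      have lc: "(l, c) \<in> arcs G"
      proof (rule ccontr)
        assume "(l, c) \<notin> arcs G"
        then have "U l c" using arc_U_cases[OF R4(2) bc] by blast
        then have "(k, c) \<in> arcs G" using IH[OF R4(2,1)] by blast
        then show False using rule1[of k c b] bc U_sym R4(6) by blast
      qed
      have "(a, l) \<notin> arcs G" using rule2[OF _ lc] ac by blast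
      then have "(l, a) \<in> arcs G \<or> U l a" using R4(4) link U_sym by blast
      then have "(k, a) \<in> arcs G"
      proof
        assume la: "(l, a) \<in> arcs G"
        have "(a, k) \<notin> arcs G"
          using acyclic_no_3cycle[OF acyclic, of a k l] la R4(1) arc by blast
        moreover have "\<not> U k a" using rule2[OF R4(1) la] .
        ultimately show ?thesis using R4(3) link U_sym by blast
      next
        assume "U l a"
        then show ?thesis using IH[OF R4(2,1)] by blast
      qed
      then have "(k, c) \<in> arcs G" using IH[OF ab _ ac] by blast
      then show False using rule1[of k c b] bc U_sym R4(6) by blast
    qed
  qed
qed

text \<open>If \<open>a\<close> and \<open>b\<close> were not linked, the collider at
  \<open>c\<close> would be oriented; if they were joined by an arc, \<open>arc_U_arc\<close> would
  orient an edge at \<open>c\<close>. This is the source of chordality.\<close>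

lemma U_moral:
  assumes "U c a" "U c b" "(a, c) \<in> H" "(b, c) \<in> H" "a \<noteq> b"
  shows "U a b"
proof -
  have "linked H a b"
    using assms coll arc_not_U(2) unfolding unshielded_collider_def by blast
  moreover have "(a, b) \<notin> arcs G" "(b, a) \<notin> arcs G"
    using arc_U_arc[of a b c] arc_U_arc[of b a c] assms(1,2) U_sym arc_not_U by blast+
  ultimately show ?thesis using link by blast
qed

text \<open>Orienting the chordal graph of undirected edges along an ordering with first node \<open>y\<close> creates
  neither cycles nor v-structures.\<close>

lemma undirected_reversible:
  assumes "U x y"
  obtains H' where "acyclic H'" "same_pattern H H'" "(y, x) \<in> H'"
proof -
  have irr: "\<not> U v v" for v
    using link[of v v] acyclic_no_loop[OF acyclic] by (auto simp: linked_def)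
  have UH: "linked H a b" if "U a b" for a b using that link by blast
  obtain xs where xs: "set xs = UNIV" "elim_ordering U xs"
    using elim_ordering_of_dag[OF acyclic, of U UNIV] UH U_moral by blast
  obtain ys ks where yk: "elim_ordering U (ys @ ks)" "set ks = {y}" "set (ys @ ks) = UNIV"
    using elim_ordering_ending_with_clique[OF U_sym xs(2), of "{y}"] xs(1) by (auto simp: pairwise_def)
  then have last: "ys @ ks \<noteq> []" "last (ys @ ks) = y" by (auto simp: last_append)
  obtain f :: "'v \<Rightarrow> nat" where f: "inj f" "f y = 0"
    "\<And>c. pairwise U {a. U c a \<and> f a < f c}"
    using elim_ordering_rank[OF yk(1), unfolded yk(3) last(2)] last(1) by auto
  define O' where "O' = {(a, b). U a b \<and> f a < f b}"
  define H' where "H' = arcs G \<union> O'"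
  have O': "(a, b) \<in> O' \<or> (b, a) \<in> O'" if "U a b" for a b
  proof -
    have "f a \<noteq> f b" using that irr f(1) by (metis injD)
    then show ?thesis using that U_sym by (auto simp: O'_def)
  qed
  have "O' \<subseteq> inv_image less_than f" by (auto simp: O'_def)
  then have acO: "acyclic O'" by (meson acyclic_subset wf_acyclic wf_inv_image wf_less_than)
  have acA: "acyclic (arcs G)" using acyclic acyclic_subset pattern by (auto simp: orients_pattern_def)
  have arc_O: "(a, c) \<in> arcs G" if "(b, c) \<in> O'\<^sup>*" "(a, b) \<in> arcs G" for a b c
    using that by (induction rule: rtrancl_induct) (auto simp: O'_def intro: arc_U_arc)
  \<comment> \<open>By \<open>arc_U_arc\<close>, an arc of \<open>G\<close> absorbs the
    \<open>O'\<close>-steps after it, so a directed path can be rewritten with its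
    \<open>O'\<close>-steps first. A cycle then collapses to one inside \<open>O'\<close> or inside
    \<open>arcs G\<close>.\<close>
  have norm: "(a, c) \<in> O'\<^sup>+ \<or> (\<exists>b. (a, b) \<in> O'\<^sup>* \<and> (b, c) \<in> (arcs G)\<^sup>+)" if "(a, c) \<in> H'\<^sup>+" for a c
    using that
  proof (induction rule: trancl_induct)
    case (base c)
    then show ?case by (auto simp: H'_def)
  next
    case (step c d)
    show ?case
    proof (cases "(c, d) \<in> arcs G")
      case True
      then show ?thesis using step.IH by (meson r_into_trancl trancl_into_rtrancl trancl_into_trancl)
    next
      case False
      then have cd: "(c, d) \<in> O'" using step.hyps(2) by (simp add: H'_def)
      from step.IH show ?thesis
      proof
        assume "(a, c) \<in> O'\<^sup>+"
        then show ?thesis using cd by (meson trancl_into_trancl)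
      next
        assume "\<exists>b. (a, b) \<in> O'\<^sup>* \<and> (b, c) \<in> (arcs G)\<^sup>+"
        then obtain b e where b: "(a, b) \<in> O'\<^sup>*" "(b, e) \<in> (arcs G)\<^sup>*" "(e, c) \<in> arcs G"
          by (meson tranclD2)
        then have "(e, d) \<in> arcs G" using arc_O cd by blast
        then show ?thesis using b by (meson rtrancl_into_trancl1)
      qed
    qed
  qed
  have acH': "acyclic H'"
  proof (rule acyclicI, rule allI, rule notI)
    fix a assume "(a, a) \<in> H'\<^sup>+"
    from norm[OF this] show False
    proof
      assume "(a, a) \<in> O'\<^sup>+"
      then show False using acO by (simp add: acyclic_def)
    next
      assume "\<exists>b. (a, b) \<in> O'\<^sup>* \<and> (b, a) \<in> (arcs G)\<^sup>+"
      then obtain b e where b: "(a, b) \<in> O'\<^sup>*" "(b, e) \<in> (arcs G)\<^sup>*" "(e, a) \<in> arcs G"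
        by (meson tranclD2)
      then have "(e, b) \<in> arcs G" using arc_O by blast
      then show False using b(2) acA by (meson acyclic_def rtrancl_into_trancl1)
    qed
  qed
  have linkH': "linked H' a b \<longleftrightarrow> linked H a b" for a b
    using O'[of a b] U_sym[of b a] unfolding link[of a b] by (auto simp: linked_def H'_def O'_def)
  have "unshielded_collider H' i k j \<longleftrightarrow> unshielded_collider H i k j" for i k j
  proof
    assume "unshielded_collider H i k j"
    then have "(i, k) \<in> arcs G" "(j, k) \<in> arcs G"
      using coll linked_sym unfolding unshielded_collider_def by metis+
    then show "unshielded_collider H' i k j"
      using \<open>unshielded_collider H i k j\<close> linkH' unfolding unshielded_collider_def H'_def by blast
  next
    assume c: "unshielded_collider H' i k j"
    then have ij: "i \<noteq> j" "\<not> linked H i j" "\<not> linked H j i"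
      using linkH' linked_sym unfolding unshielded_collider_def by metis+
    have "\<not> ((i, k) \<in> O' \<and> (j, k) \<in> O')"
      using f(3)[of k] ij U_sym link unfolding pairwise_def O'_def by blast
    moreover have "\<not> ((i, k) \<in> arcs G \<and> (j, k) \<in> O')" "\<not> ((i, k) \<in> O' \<and> (j, k) \<in> arcs G)"
      using rule1[of i k j] rule1[of j k i] ij U_sym unfolding O'_def by blast+
    ultimately have "(i, k) \<in> arcs G" "(j, k) \<in> arcs G"
      using c unfolding unshielded_collider_def H'_def by blast+
    then show "unshielded_collider H i k j" using ij arc unfolding unshielded_collider_def by blast
  qed
  then have "same_pattern H H'" using linkH' by (simp add: same_pattern_def fun_eq_iff)
  moreover have "(y, x) \<in> H'"
    using assms U_sym irr f(1,2) unfolding H'_def O'_def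
    by (metis (mono_tags, lifting) UnI2 bot_nat_0.not_eq_extremum case_prodI injD mem_Collect_eq)
  ultimately show thesis using that acH' by blast
qed

end

section \<open>From separating sets to the CPDAG\<close>

lemma collider_arcs_iff:
  assumes "acyclic H" "E = skeleton (of_digraph H)"
    and "\<And>i k j. linked H i k \<Longrightarrow> linked H k j \<Longrightarrow> \<not> linked H i j \<Longrightarrow> i \<noteq> j \<Longrightarrow>
      unshielded_collider H i k j \<longleftrightarrow> k \<notin> S {i, j}"
  shows "(i, k) \<in> collider_arcs E S \<longleftrightarrow> (\<exists>j. unshielded_collider H i k j)"
proof
  assume "(i, k) \<in> collider_arcs E S"
  then show "\<exists>j. unshielded_collider H i k j"
    using assms(2,3) by (auto simp: collider_arcs_def in_skeleton_of_digraph)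
next
  assume "\<exists>j. unshielded_collider H i k j"
  then obtain j where j: "unshielded_collider H i k j" ..
  then have "linked H i k" "linked H k j" "\<not> linked H i j" "i \<noteq> j"
    by (auto simp: unshielded_collider_def linked_def)
  then show "(i, k) \<in> collider_arcs E S"
    using assms(2,3) j unfolding collider_arcs_def by (auto simp: in_skeleton_of_digraph)
qed

lemma skeleton_collider_orientation:
  assumes "collider_orientation E S G"
  shows "skeleton G = E"
proof -
  have "{i, k} \<in> E" if "(i, k) \<in> arcs G" for i k
    using assms that by (auto simp: collider_orientation_def collider_arcs_def)
  then show ?thesis using assms by (auto simp: skeleton_def collider_orientation_def)
qed

lemma skeleton_oriented_graph: "oriented_graph E S G \<Longrightarrow> skeleton G = E"
  unfolding oriented_graph_def using skeleton_collider_orientation skeleton_meek_steps by metis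

text \<open>The rules are sound for every DAG with the pattern of \<open>H\<close>, so the arcs of
  \<open>G\<close> are common to the whole class; \<open>undirected_reversible\<close> shows that no
  other arc is.\<close>

lemma oriented_graph_eq_cpdag:
  fixes H :: "('v::finite \<times> 'v) set"
  assumes ac: "acyclic H"
    and sep: "\<And>i k j. linked H i k \<Longrightarrow> linked H k j \<Longrightarrow> \<not> linked H i j \<Longrightarrow> i \<noteq> j \<Longrightarrow>
      unshielded_collider H i k j \<longleftrightarrow> k \<notin> S {i, j}"
    and G: "oriented_graph (skeleton (of_digraph H)) S G"
  shows "G = cpdag H" and "consistent_extension G H"
proof -
  let ?E = "skeleton (of_digraph H)"
  obtain G\<^sub>0 where G\<^sub>0: "collider_orientation ?E S G\<^sub>0" "meek_step\<^sup>*\<^sup>* G\<^sub>0 G"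
    and closed: "\<not> meek_step G G'" for G'
    using G unfolding oriented_graph_def by blast
  have ca: "(i, k) \<in> collider_arcs ?E S \<longleftrightarrow> (\<exists>j. unshielded_collider H i k j)" for i k
    using collider_arcs_iff[OF ac refl] sep by blast
  have arcs\<^sub>0: "(i, k) \<in> arcs G\<^sub>0 \<longleftrightarrow> (\<exists>j. unshielded_collider H i k j)" for i k
  proof
    assume "(i, k) \<in> arcs G\<^sub>0"
    then show "\<exists>j. unshielded_collider H i k j"
      using G\<^sub>0(1) ca unfolding collider_orientation_def by blast
  next
    \<comment> \<open>With correct separating sets no edge is demanded in both directions, so there
      is no conflict to be resolved arbitrarily.\<close>
    assume ex: "\<exists>j. unshielded_collider H i k j"
    then have "(i, k) \<in> H" by (auto simp: unshielded_collider_def)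
    then have "\<not> (\<exists>j. unshielded_collider H k i j)"
      using acyclic_no_2cycle[OF ac] unfolding unshielded_collider_def by blast
    then have "(k, i) \<notin> arcs G\<^sub>0" using G\<^sub>0(1) ca unfolding collider_orientation_def by blast
    moreover have "(i, k) \<in> arcs G\<^sub>0 \<or> (k, i) \<in> arcs G\<^sub>0"
      using G\<^sub>0(1) ex ca[of i k] unfolding collider_orientation_def by blast
    ultimately show "(i, k) \<in> arcs G\<^sub>0" by blast
  qed
  have sound: "orients_pattern K G \<and> (\<forall>(a, b) \<in> arcs G. justified K G a b)"
    if K: "acyclic K" "same_pattern H K" for K
  proof (rule meek_steps_sound[OF G\<^sub>0(2) K(1)])
    have eq: "skeleton (of_digraph K) = ?E" "unshielded_collider K = unshielded_collider H"
      using K(2) skeleton_of_digraph_eq_iff[of K H] by (auto simp: same_pattern_def)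
    have "(i, k) \<in> K" if "(i, k) \<in> arcs G\<^sub>0" for i k
      using that unfolding arcs\<^sub>0 eq(2)[symmetric] unshielded_collider_def by blast
    moreover have "{i, j} \<notin> undirected G\<^sub>0" if "(i, j) \<in> arcs G\<^sub>0" for i j
      using that G\<^sub>0(1) unfolding collider_orientation_def by blast
    ultimately show "orients_pattern K G\<^sub>0"
      using skeleton_collider_orientation[OF G\<^sub>0(1)] eq arcs\<^sub>0
      unfolding orients_pattern_def by auto
    show "\<forall>(a, b) \<in> arcs G\<^sub>0. justified K G\<^sub>0 a b"
      using arcs\<^sub>0 eq(2) unfolding justified_def by auto
  qed
  have HH: "same_pattern H H" by (simp add: same_pattern_def)
  interpret meek_closed H G
    using ac sound[OF ac HH] closed by unfold_locales auto
  have D: "{(i, j) \<in> H. \<forall>K. acyclic K \<longrightarrow> markov_equivalent H K \<longrightarrow> (i, j) \<in> K} = arcs G" (is "?D = _")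
  proof (intro set_eqI iffI)
    fix e assume "e \<in> arcs G"
    then obtain i j where e: "e = (i, j)" "(i, j) \<in> arcs G" by (cases e) auto
    have "(i, j) \<in> K" if "acyclic K" "markov_equivalent H K" for K
      using sound[OF that(1) markov_equivalent_imp_same_pattern[OF ac that]] e(2)
      by (auto simp: orients_pattern_def)
    then show "e \<in> ?D" using e arc by blast
  next
    fix e assume "e \<in> ?D"
    then obtain i j where e: "e = (i, j)" "(i, j) \<in> H"
      "\<And>K. acyclic K \<Longrightarrow> markov_equivalent H K \<Longrightarrow> (i, j) \<in> K" by blast
    show "e \<in> arcs G"
    proof (rule ccontr)
      assume "e \<notin> arcs G"
      moreover have "(j, i) \<notin> arcs G" using e(2) arc acyclic_no_2cycle[OF ac] by blast
      ultimately have "U i j" using e(1,2) link[of i j] by (simp add: linked_def)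
      then obtain K where K: "acyclic K" "same_pattern H K" "(j, i) \<in> K"
        using undirected_reversible by blast
      then show False
        using e(3) same_pattern_imp_markov_equivalent[OF ac] acyclic_no_2cycle[OF K(1)] by blast
    qed
  qed
  have und: "undirected G = {{i, j} | i j. (i, j) \<in> H - arcs G}"
  proof (intro set_eqI iffI)
    fix e assume e: "e \<in> undirected G"
    then have "e \<in> ?E" using pattern by (auto simp: orients_pattern_def skeleton_def)
    then obtain i j where "e = {i, j}" "(i, j) \<in> H" by (auto simp: skeleton_def of_digraph_def)
    then show "e \<in> {{i, j} | i j. (i, j) \<in> H - arcs G}" using e arc_not_U by blast
  next
    fix e assume "e \<in> {{i, j} | i j. (i, j) \<in> H - arcs G}"
    then obtain i j where e: "e = {i, j}" "(i, j) \<in> H" "(i, j) \<notin> arcs G" by blast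
    moreover have "(j, i) \<notin> arcs G" using e(2) arc acyclic_no_2cycle[OF ac] by blast
    ultimately show "e \<in> undirected G" using link[of i j] by (simp add: linked_def)
  qed
  show "G = cpdag H"
    unfolding cpdag_def Let_def D using und by simp
  have "v_structures (of_digraph H) = v_structures G"
  proof -
    have "unshielded_collider H i k j \<longleftrightarrow> (i, k, j) \<in> v_structures G" for i k j
    proof
      assume c: "unshielded_collider H i k j"
      then have "unshielded_collider H j k i"
        using linked_sym[of H j i] unfolding unshielded_collider_def by blast
      then show "(i, k, j) \<in> v_structures G"
        using c coll[of i k j] coll[of j k i] unfolding v_structures_def adj
        by (simp add: unshielded_collider_def)
    next
      assume "(i, k, j) \<in> v_structures G"
      then show "unshielded_collider H i k j"
        using arc[of i k] arc[of j k] unfolding v_structures_def adj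
        by (simp add: unshielded_collider_def)
    qed
    then show ?thesis using v_structures_of_digraph by fast
  qed
  then show "consistent_extension G H"
    using ac pattern by (auto simp: consistent_extension_def orients_pattern_def)
qed

lemma consistent_extension_same_pattern:
  assumes "consistent_extension G H" "consistent_extension G K"
  shows "same_pattern H K"
  using assms skeleton_of_digraph_eq_iff[of H K] v_structures_of_digraph_eq_iff[of H K]
  by (simp add: consistent_extension_def same_pattern_def)

section \<open>The PATH algorithm on well-separated p-values\<close>

text \<open>If exactly \<open>N > 0\<close> values are at most \<open>a\<close>, then the
  \<open>N\<close>-th smallest is the largest of these, so cutting there instead of at
  \<open>a\<close> changes nothing, even with ties.\<close>

lemma edges_at_order_statistic:
  fixes \<Phi> :: "'v::finite set \<Rightarrow> real"
  assumes "edges_at \<Phi> a \<noteq> {}"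
  shows "edges_at \<Phi> (order_statistic \<Phi> (card (edges_at \<Phi> a))) = edges_at \<Phi> a"
proof -
  define L where "L = sorted_list_of_multiset (image_mset \<Phi> (mset_set (node_pairs :: 'v set set)))"
  define I where "I = {i. i < length L \<and> L ! i \<le> a}"
  have L: "sorted L" "mset L = image_mset \<Phi> (mset_set node_pairs)"
    by (simp_all add: L_def)
  have setL: "set L = \<Phi> ` node_pairs"
    using arg_cong[OF L(2), of set_mset] by simp
  have "card I = size (filter_mset (\<lambda>x. x \<le> a) (mset L))"
    unfolding I_def by (simp only: mset_filter[symmetric] size_mset length_filter_conv_card)
  also have "\<dots> = card (edges_at \<Phi> a)"
    unfolding L(2) by (simp add: filter_mset_image_mset edges_at_def)
  finally have cardI: "card I = card (edges_at \<Phi> a)" .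
  have fin: "finite I" by (simp add: I_def)
  have "I \<noteq> {}" using cardI assms by (metis card.empty card_eq_0_iff finite)
  define m where "m = Max I"
  have m: "m \<in> I" "\<And>i. i \<in> I \<Longrightarrow> i \<le> m"
    using fin \<open>I \<noteq> {}\<close> by (simp_all add: m_def)
  have "I = {..m}"
  proof (intro set_eqI iffI)
    fix i assume "i \<in> {..m}"
    then show "i \<in> I"
      using m(1) sorted_nth_mono[OF L(1), of i m] by (auto simp: I_def)
  qed (use m(2) in simp)
  then have "card (edges_at \<Phi> a) - 1 = m" using cardI by simp
  then have os: "order_statistic \<Phi> (card (edges_at \<Phi> a)) = L ! m"
    by (simp add: order_statistic_def L_def)
  have "\<Phi> e \<le> L ! m" if "e \<in> edges_at \<Phi> a" for e
  proof -
    have "\<Phi> e \<in> set L" "\<Phi> e \<le> a" using that setL by (auto simp: edges_at_def)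
    then obtain i where i: "i < length L" "L ! i = \<Phi> e" by (auto simp: in_set_conv_nth)
    then have "i \<le> m" using m(2) \<open>\<Phi> e \<le> a\<close> by (simp add: I_def)
    then show ?thesis using sorted_nth_mono[OF L(1), of i m] m(1) i by (simp add: I_def)
  qed
  moreover have "L ! m \<le> a" using m(1) by (simp add: I_def)
  ultimately show ?thesis unfolding os by (force simp: edges_at_def)
qed

lemma path_threshold_attains:
  fixes \<Phi> :: "'v::finite set \<Rightarrow> real"
  assumes "0 \<le> a" "a \<le> \<alpha>"
  obtains t where "t \<in> {1..num_thresholds \<Phi> \<alpha>}"
    "edges_at \<Phi> (path_threshold \<Phi> \<alpha> t) = edges_at \<Phi> a"
proof -
  let ?N = "card (edges_at \<Phi> a)" and ?M = "card (edges_at \<Phi> \<alpha>)"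
  have sub: "edges_at \<Phi> a \<subseteq> edges_at \<Phi> \<alpha>" using assms(2) by (auto simp: edges_at_def)
  then have le: "?N \<le> ?M" by (simp add: card_mono)
  have M: "num_thresholds \<Phi> \<alpha> = ?M + 1" by (simp add: num_thresholds_def)
  show thesis
  proof (cases "?N = ?M")
    case True
    then have "edges_at \<Phi> a = edges_at \<Phi> \<alpha>" using sub by (simp add: card_subset_eq)
    then show thesis using that[of 1] M by (simp add: path_threshold_def)
  next
    case False
    \<comment> \<open>Stage \<open>t\<close> cuts at the \<open>(M + 1 - t)\<close>-th smallest
      value, so this \<open>t\<close> asks for the \<open>?N\<close>-th. If \<open>?N = 0\<close>,
      it is the final stage with threshold \<open>0\<close>, below \<open>a\<close>.\<close>
    let ?t = "?M + 1 - ?N"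
    have "edges_at \<Phi> (path_threshold \<Phi> \<alpha> ?t) = edges_at \<Phi> a"
    proof (cases "edges_at \<Phi> a = {}")
      case True
      then have "path_threshold \<Phi> \<alpha> ?t = 0"
        using False le by (simp add: path_threshold_def M)
      moreover have "edges_at \<Phi> 0 \<subseteq> edges_at \<Phi> a" using assms(1) by (auto simp: edges_at_def)
      ultimately show ?thesis using True by simp
    next
      case ne: False
      then have "?N > 0" by (simp add: card_gt_0_iff)
      then have "?t \<noteq> 1" "?t \<le> ?M" "?M + 1 - ?t = ?N" using False le by linarith+
      then have "path_threshold \<Phi> \<alpha> ?t = order_statistic \<Phi> ?N"
        unfolding path_threshold_def M by (simp add: Let_def)
      then show ?thesis using edges_at_order_statistic[OF ne] by simp
    qed
    then show thesis using that[of ?t] le M by (simp add: Suc_diff_le)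
  qed
qed

lemma exists_is_arg_max_acyclic:
  fixes f :: "('v::finite \<times> 'v) set \<Rightarrow> real"
  shows "\<exists>G. is_arg_max f acyclic G"
proof -
  have fin: "finite (f ` {G. acyclic G})" by simp
  have "acyclic ({} :: ('v \<times> 'v) set)" by (simp add: acyclic_def)
  then have "f ` {G. acyclic G} \<noteq> {}" by blast
  from Max_in[OF fin this] obtain G where G: "acyclic G" "f G = Max (f ` {G. acyclic G})" by auto
  have "f H \<le> f G" if "acyclic H" for H using that fin G(2) by simp
  then show ?thesis using G(1) by (auto simp: is_arg_max_def not_less)
qed

section \<open>Recovery of skeleton and CPDAG from one data set\<close>

lemma node_pairs_iff: "{i, j} \<in> node_pairs \<longleftrightarrow> i \<noteq> j"
  by (auto simp: node_pairs_def card_insert_if)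

lemma node_pairsE:
  assumes "e \<in> node_pairs"
  obtains i j where "e = {i, j}" "i \<noteq> j"
  using assms by (auto simp: node_pairs_def card_2_iff)

text \<open>A nonadjacent pair was either removed, by a p-value above
  \<open>\<alpha> \<ge> a\<close>, or survived. In the latter case the parents of both nodes lie
  among their estimated neighbours, since no true edge is lost, and one of the two parent sets
  separates. Surviving false edges do no harm: they only enlarge the neighbourhoods to be
  tested.\<close>

lemma exhaustive_investigation_recovers:
  fixes H :: "('v::finite \<times> 'v) set" and q :: "'v set \<Rightarrow> 'v set \<Rightarrow> real"
  assumes ac: "acyclic H" and le: "a \<le> \<alpha>"
    and dep: "\<And>i j k. i \<noteq> j \<Longrightarrow> k \<subseteq> UNIV - {i, j} \<Longrightarrow> d_connected H k i j \<Longrightarrow> q {i, j} k \<le> a"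
    and indep: "\<And>i j k. i \<noteq> j \<Longrightarrow> k \<subseteq> UNIV - {i, j} \<Longrightarrow> \<not> d_connected H k i j \<Longrightarrow> a < q {i, j} k"
    and inv: "exhaustive_investigation q \<alpha> K" and S: "recorded_sepsets q K S"
  shows "edges_at (max_pvalue q K) a = skeleton (of_digraph H)"
    and "i \<noteq> j \<Longrightarrow> \<not> linked H i j \<Longrightarrow>
      \<not> d_connected H (S {i, j}) i j \<and> S {i, j} \<subseteq> UNIV - {i, j}"
proof -
  let ?\<Phi> = "max_pvalue q K"
  define E where "E = estimated_skeleton q \<alpha> K"
  have sub: "k \<subseteq> UNIV - {i, j}" if "i \<noteq> j" "k \<in> K {i, j}" for i j k
    using inv that node_pairs_iff[of i j] unfolding exhaustive_investigation_def by blast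
  have exh: "k \<in> K {i, j}"
    if "{i, j} \<in> E" "k \<subseteq> neighbors E i - {j} \<or> k \<subseteq> neighbors E j - {i}" for i j k
    using inv that unfolding exhaustive_investigation_def E_def Let_def by blast
  have Smem: "S {i, j} \<in> K {i, j}" "q {i, j} (S {i, j}) = ?\<Phi> {i, j}" if "i \<noteq> j" for i j
    using S that node_pairs_iff[of i j] unfolding recorded_sepsets_def by blast+
  have ge: "q e k \<le> ?\<Phi> e" if "k \<in> K e" for e k
    using that by (simp add: max_pvalue_def)
  have ne: "i \<noteq> j" if "linked H i j" for i j
    using that acyclic_no_loop[OF ac] by (auto simp: linked_def)
  have edge: "q {i, j} k \<le> a" if "linked H i j" "k \<in> K {i, j}" for i j k
  proof -
    have k: "k \<subseteq> UNIV - {i, j}" using sub ne that by blast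
    then have "i \<notin> k" by blast
    then show ?thesis using dep[OF ne[OF that(1)] k] d_connected_linked[OF that(1)] by blast
  qed
  have true_edge: "{i, j} \<in> E" if "linked H i j" for i j
    using edge[OF that] le ne[OF that] node_pairs_iff[of i j]
    unfolding E_def estimated_skeleton_def by fastforce
  have par: "parents H i \<subseteq> neighbors E i" for i
    using true_edge[of i] by (auto simp: parents_def neighbors_def linked_def)
  have nonedge: "a < ?\<Phi> {i, j}" if ij: "i \<noteq> j" "\<not> linked H i j" for i j
  proof (cases "{i, j} \<in> E")
    case True
    have ji: "{j, i} = {i, j}" by blast
    from separating_set_exists[OF ac ij(2,1)] obtain k where
      "k \<in> K {i, j}" "a < q {i, j} k"
    proof (elim disjE conjE)
      assume k: "\<not> d_connected H (parents H i) i j" "j \<notin> parents H i" "i \<notin> parents H i"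
      then have "parents H i \<in> K {i, j}" using exh[OF True] par[of i] by blast
      moreover have "a < q {i, j} (parents H i)" using indep[OF ij(1) _ k(1)] k(2,3) by blast
      ultimately show thesis using that by blast
    next
      assume k: "\<not> d_connected H (parents H j) j i" "i \<notin> parents H j" "j \<notin> parents H j"
      then have "parents H j \<in> K {i, j}" using exh[OF True] par[of j] by blast
      moreover have "a < q {j, i} (parents H j)" using indep[OF ij(1)[symmetric] _ k(1)] k(2,3) by blast
      ultimately show thesis using that ji by simp
    qed
    then show ?thesis using ge[of k "{i, j}"] by simp
  next
    case False
    then obtain k where "k \<in> K {i, j}" "\<alpha> < q {i, j} k"
      using ij(1) node_pairs_iff[of i j] unfolding E_def estimated_skeleton_def by blast
    then show ?thesis using ge[of k "{i, j}"] le by simp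
  qed
  have "{i, j} \<in> edges_at ?\<Phi> a \<longleftrightarrow> linked H i j" if "i \<noteq> j" for i j
    using nonedge[OF that] edge[of i j "S {i, j}"] Smem[OF that] that node_pairs_iff[of i j]
    unfolding edges_at_def by fastforce
  then show "edges_at ?\<Phi> a = skeleton (of_digraph H)"
  proof (intro set_eqI iffI)
    fix e assume e: "e \<in> edges_at ?\<Phi> a"
    then obtain i j where "e = {i, j}" "i \<noteq> j" using node_pairsE[of e] by (auto simp: edges_at_def)
    then show "e \<in> skeleton (of_digraph H)"
      using e \<open>\<And>j i. i \<noteq> j \<Longrightarrow> ({i, j} \<in> edges_at ?\<Phi> a) = linked H i j\<close>
      by (simp add: in_skeleton_of_digraph)
  next
    fix e assume e: "e \<in> skeleton (of_digraph H)"
    then obtain i j where "e = {i, j}" by (auto simp: skeleton_def of_digraph_def)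
    then show "e \<in> edges_at ?\<Phi> a"
      using e ne \<open>\<And>j i. i \<noteq> j \<Longrightarrow> ({i, j} \<in> edges_at ?\<Phi> a) = linked H i j\<close>
      by (simp add: in_skeleton_of_digraph)
  qed
  \<comment> \<open>The recorded set attains a maximum above \<open>a\<close>, which no dependence
    does.\<close>
  show "\<not> d_connected H (S {i, j}) i j \<and> S {i, j} \<subseteq> UNIV - {i, j}"
    if "i \<noteq> j" "\<not> linked H i j"
    using dep[OF that(1) sub[OF that(1) Smem(1)[OF that(1)]]] nonedge[OF that] Smem[OF that(1)]
      sub[OF that(1)] by force
qed

text \<open>The deterministic core: chance enters only through \<open>dep\<close>,
  \<open>indep\<close> and \<open>max\<close>, and the conclusion holds for every output that the
  relation allows.\<close>

lemma path_estimate_eq_cpdag: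
  fixes H :: "('v::finite \<times> 'v) set"
    and pval :: "'v data \<Rightarrow> 'v set \<Rightarrow> 'v set \<Rightarrow> real"
  assumes ac: "acyclic H" and a: "0 \<le> a" "a \<le> \<alpha>"
    and dep: "\<And>i j k. i \<noteq> j \<Longrightarrow> k \<subseteq> UNIV - {i, j} \<Longrightarrow> d_connected H k i j \<Longrightarrow> pval d {i, j} k \<le> a"
    and indep: "\<And>i j k. i \<noteq> j \<Longrightarrow> k \<subseteq> UNIV - {i, j} \<Longrightarrow> \<not> d_connected H k i j \<Longrightarrow> a < pval d {i, j} k"
    and eq: "score_equivalent \<phi>"
    and max: "\<And>G. is_arg_max (\<lambda>G. \<phi> G d) acyclic G \<Longrightarrow> markov_equivalent H G"
    and est: "path_estimate pval \<phi> \<alpha> d G"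
  shows "G = cpdag H"
proof -
  obtain K S where inv: "exhaustive_investigation (pval d) \<alpha> K" and S: "recorded_sepsets (pval d) K S"
    and out: "path_output \<phi> d S (max_pvalue (pval d) K) (num_thresholds (max_pvalue (pval d) K) \<alpha>)
      (path_threshold (max_pvalue (pval d) K) \<alpha>) G"
    using est unfolding path_estimate_def Let_def by blast
  let ?\<Phi> = "max_pvalue (pval d) K" and ?E = "skeleton (of_digraph H)"
  let ?\<tau> = "num_thresholds ?\<Phi> \<alpha>" and ?\<alpha>s = "path_threshold ?\<Phi> \<alpha>"
  have E: "edges_at ?\<Phi> a = ?E"
    using exhaustive_investigation_recovers(1)[OF ac a(2) dep indep inv S] by blast
  have sep: "\<not> d_connected H (S {i, j}) i j \<and> S {i, j} \<subseteq> UNIV - {i, j}"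
    if "i \<noteq> j" "\<not> linked H i j" for i j
    using exhaustive_investigation_recovers(2)[OF ac a(2) dep indep inv S that] by blast
  have "unshielded_collider H i k j \<longleftrightarrow> k \<notin> S {i, j}"
    if "linked H i k" "linked H k j" "\<not> linked H i j" "i \<noteq> j" for i k j
    using unshielded_collider_iff_not_in_separating_set[OF ac that(1-4)] sep[OF that(4,3)] by blast
  note cp = oriented_graph_eq_cpdag[OF ac this]
  obtain t\<^sub>0 where t\<^sub>0: "t\<^sub>0 \<in> {1..?\<tau>}" "edges_at ?\<Phi> (?\<alpha>s t\<^sub>0) = ?E"
    using path_threshold_attains[OF a] E by metis
  obtain \<G> \<H> ts where or: "\<And>t. t \<in> {1..?\<tau>} \<Longrightarrow> oriented_graph (edges_at ?\<Phi> (?\<alpha>s t)) S (\<G> t)"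
    and sel: "let T = {t \<in> {1..?\<tau>}. \<exists>H. consistent_extension (\<G> t) H} in
         if T \<noteq> {} then
           (\<forall>t\<in>T. consistent_extension (\<G> t) (\<H> t)) \<and>
           is_arg_max (\<lambda>t. \<phi> (\<H> t) d) (\<lambda>t. t \<in> T) ts
         else
           (\<forall>t\<in>{1..?\<tau>}. fallback_dag (\<G> t) (\<H> t)) \<and>
           is_arg_max (\<lambda>t. \<phi> (\<H> t) d) (\<lambda>t. t \<in> {1..?\<tau>}) ts"
    and G: "G = \<G> ts"
    using out unfolding path_output_def by blast
  define T where "T = {t \<in> {1..?\<tau>}. \<exists>H. consistent_extension (\<G> t) H}"
  have ext\<^sub>0: "consistent_extension (\<G> t\<^sub>0) H" using cp(2) or[OF t\<^sub>0(1)] t\<^sub>0(2) by simp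
  then have "t\<^sub>0 \<in> T" using t\<^sub>0(1) by (auto simp: T_def)
  then have "T \<noteq> {}" by blast
  with sel have ext: "\<And>t. t \<in> T \<Longrightarrow> consistent_extension (\<G> t) (\<H> t)"
    and ts: "is_arg_max (\<lambda>t. \<phi> (\<H> t) d) (\<lambda>t. t \<in> T) ts"
    unfolding T_def[symmetric] Let_def by auto
  have tsT: "ts \<in> T" using ts by (simp add: is_arg_max_def)
  have acH: "acyclic (\<H> t)" if "t \<in> T" for t
    using ext[OF that] by (simp add: consistent_extension_def)
  \<comment> \<open>The extension chosen at stage \<open>t\<^sub>0\<close> may differ from
    \<open>H\<close>; score equivalence makes it as good.\<close>
  have "markov_equivalent H (\<H> t\<^sub>0)"
    using same_pattern_imp_markov_equivalent[OF ac acH consistent_extension_same_pattern]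
      ext\<^sub>0 ext \<open>t\<^sub>0 \<in> T\<close> by blast
  then have "\<phi> (\<H> t\<^sub>0) d = \<phi> H d"
    using eq ac acH[OF \<open>t\<^sub>0 \<in> T\<close>] unfolding score_equivalent_def by metis
  moreover have "\<phi> (\<H> t\<^sub>0) d \<le> \<phi> (\<H> ts) d"
    using ts \<open>t\<^sub>0 \<in> T\<close> by (auto simp: is_arg_max_def not_less)
  moreover obtain G\<^sub>1 where G\<^sub>1: "is_arg_max (\<lambda>G. \<phi> G d) acyclic G\<^sub>1"
    using exists_is_arg_max_acyclic[of "\<lambda>G. \<phi> G d"] by blast
  then have "\<phi> H d = \<phi> G\<^sub>1 d"
    using max eq ac unfolding score_equivalent_def is_arg_max_def by metis
  ultimately have "is_arg_max (\<lambda>G. \<phi> G d) acyclic (\<H> ts)"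
    using G\<^sub>1 acH[OF tsT] by (fastforce simp: is_arg_max_def)
  then have "same_pattern H (\<H> ts)"
    using markov_equivalent_imp_same_pattern[OF ac acH[OF tsT]] max by blast
  then have "skeleton (of_digraph (\<H> ts)) = ?E"
    by (simp add: skeleton_of_digraph_eq_iff same_pattern_def)
  moreover have "skeleton (of_digraph (\<H> ts)) = skeleton (\<G> ts)"
    using ext[OF tsT] by (simp add: consistent_extension_def)
  moreover have or_ts: "oriented_graph (edges_at ?\<Phi> (?\<alpha>s ts)) S (\<G> ts)"
    using or tsT by (simp add: T_def)
  \<comment> \<open>The selected stage may differ from \<open>t\<^sub>0\<close>, but it has the true
    skeleton as well, and this together with \<open>S\<close> forces the CPDAG.\<close>
  ultimately have "oriented_graph ?E S (\<G> ts)"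
    using skeleton_oriented_graph[OF or_ts] by simp
  then show ?thesis using cp(1) G by simp
qed

section \<open>Convergence in probability\<close>

text \<open>The tolerance \<open>1/(m+1)\<close> is adopted only once \<open>n\<close> has passed
  the index \<open>N m\<close> from which it is met. As \<open>f\<close> is evaluated exactly at
  these tolerances, no monotonicity in \<open>\<epsilon>\<close> is involved.\<close>

lemma diagonal_null_sequence:
  fixes f :: "real \<Rightarrow> nat \<Rightarrow> real"
  assumes "\<And>\<epsilon>. \<epsilon> > 0 \<Longrightarrow> f \<epsilon> \<longlonglongrightarrow> 0"
  shows "\<exists>a :: nat \<Rightarrow> real. a \<longlonglongrightarrow> 0 \<and> (\<forall>n. a n > 0) \<and> (\<lambda>n. f (a n) n) \<longlonglongrightarrow> 0"
proof -
  have "\<exists>N. \<forall>n\<ge>N. \<bar>f (inverse (real (Suc m))) n\<bar> < inverse (real (Suc m))" for m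
    using LIMSEQ_D[OF assms, of "inverse (real (Suc m))" "inverse (real (Suc m))"] by simp
  then obtain N where
    N: "\<And>m n. n \<ge> N m \<Longrightarrow> \<bar>f (inverse (real (Suc m))) n\<bar> < inverse (real (Suc m))"
    by metis
  \<comment> \<open>The bound \<open>m \<le> n\<close> keeps the set finite, and inserting
    \<open>0\<close> keeps it nonempty for \<open>n\<close> below \<open>N 0\<close>.\<close>
  define A where "A n = insert 0 {m. m \<le> n \<and> N m \<le> n}" for n
  define k where "k n = Max (A n)" for n
  have fin: "finite (A n)" for n by (simp add: A_def)
  have k_ge: "m \<le> k n" if "m \<le> n" "N m \<le> n" for m n
    unfolding k_def using that by (intro Max_ge[OF fin]) (simp add: A_def)
  have Nk: "N (k n) \<le> n" if "N 0 \<le> n" for n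
    using Max_in[OF fin, of n] that by (auto simp: A_def k_def)
  define a where "a n = inverse (real (Suc (k n)))" for n
  have "filterlim k at_top sequentially"
    unfolding filterlim_at_top
  proof
    fix m
    show "\<forall>\<^sub>F n in sequentially. m \<le> k n"
      using k_ge by (intro eventually_sequentiallyI[of "max m (N m)"]) simp
  qed
  then have a: "a \<longlonglongrightarrow> 0"
    unfolding a_def using filterlim_compose[OF LIMSEQ_inverse_real_of_nat] by blast
  have "\<forall>\<^sub>F n in sequentially. norm (f (a n) n) \<le> a n"
    using N[OF Nk] by (intro eventually_sequentiallyI[of "N 0"]) (simp add: a_def less_imp_le)
  then have "(\<lambda>n. f (a n) n) \<longlonglongrightarrow> 0" by (rule Lim_null_comparison[OF _ a])
  then show ?thesis using a by (intro exI[of _ a]) (simp add: a_def)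
qed

section \<open>Asymptotically uniform p-values\<close>

lemma cdf_uniform_01:
  assumes "0 < x" "x < 1"
  shows "cdf (uniform_measure lborel {0..1}) x = x"
proof -
  have "{0..1} \<inter> {..x} = {0..x}" using assms by auto
  then show ?thesis using assms by (simp add: cdf_def)
qed

lemma isCont_cdf_uniform_01:
  assumes "0 < x" "x < 1"
  shows "isCont (cdf (uniform_measure lborel {0..1})) x"
proof -
  have "\<forall>\<^sub>F y in nhds x. y \<in> {0<..<1::real}"
    using assms by (intro eventually_nhds_in_open) auto
  then have "\<forall>\<^sub>F y in nhds x. cdf (uniform_measure lborel {0..1}) y = y"
    by (rule eventually_mono) (simp add: cdf_uniform_01)
  then show ?thesis using isCont_cong[of "cdf (uniform_measure lborel {0..1})" "\<lambda>y. y" x] by simp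
qed

lemma (in prob_space) weak_conv_uniform_prob_le_null:
  assumes [measurable]: "\<And>n. X n \<in> borel_measurable M"
    and conv: "weak_conv_m (\<lambda>n. distr M borel (X n)) (uniform_measure lborel {0..1})"
    and a: "a \<longlonglongrightarrow> 0"
  shows "(\<lambda>n. \<P>(\<omega> in M. X n \<omega> \<le> a n)) \<longlonglongrightarrow> 0"
proof (rule tendstoI)
  fix e :: real assume "e > 0"
  \<comment> \<open>Strictly below \<open>e\<close>, and inside \<open>(0,1)\<close>, where the
    limiting cdf is continuous and equal to the identity.\<close>
  define x where "x = min (e / 2) (1 / 2)"
  have x: "0 < x" "x < 1" "x < e" using \<open>e > 0\<close> by (auto simp: x_def)
  have "(\<lambda>n. cdf (distr M borel (X n)) x) \<longlonglongrightarrow> x"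
    using conv isCont_cdf_uniform_01[OF x(1,2)] cdf_uniform_01[OF x(1,2)]
    unfolding weak_conv_m_def weak_conv_def by metis
  moreover have "cdf (distr M borel (X n)) x = \<P>(\<omega> in M. X n \<omega> \<le> x)" for n
    by (simp add: cdf_def measure_distr vimage_def Int_def conj_commute)
  ultimately have "\<forall>\<^sub>F n in sequentially. \<P>(\<omega> in M. X n \<omega> \<le> x) < e"
    using order_tendstoD(2)[OF _ x(3)] by simp
  moreover have "\<forall>\<^sub>F n in sequentially. a n < x" using order_tendstoD(2)[OF a x(1)] .
  ultimately show "\<forall>\<^sub>F n in sequentially. dist (\<P>(\<omega> in M. X n \<omega> \<le> a n)) 0 < e"
  proof eventually_elim
    case (elim n)
    have "\<P>(\<omega> in M. X n \<omega> \<le> a n) \<le> \<P>(\<omega> in M. X n \<omega> \<le> x)"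
      using elim(2) by (intro finite_measure_mono) auto
    then show ?case using elim(1) by simp
  qed
qed

text \<open>For finite \<open>'v\<close> there are only countably many data sets, so the discrete
  sigma-algebra can be used and every property of the data is an event, whatever the test, the score
  and the estimator are.\<close>

lemma measurable_dataset:
  fixes Y :: "nat \<Rightarrow> 'w \<Rightarrow> 'v::finite \<Rightarrow> nat"
  assumes [measurable]: "\<And>m. Y m \<in> measurable M (count_space UNIV)"
  shows "dataset Y n \<in> measurable M (count_space UNIV)"
proof (induction n)
  case 0
  then show ?case by (simp add: dataset_def)
next
  case (Suc n)
  have "(\<lambda>\<omega>. d @ [Y n \<omega>]) \<in> measurable M (count_space UNIV)" for d
    using measurable_compose[OF assms(1)[of n], of "\<lambda>y. d @ [y]"] by simp
  then have "(\<lambda>\<omega>. dataset Y n \<omega> @ [Y n \<omega>]) \<in> measurable M (count_space UNIV)"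
    using Suc by (rule measurable_compose_countable)
  then show ?case by (simp add: dataset_def)
qed

lemma (in prob_space) prob_ex_null:
  assumes "finite T"
    and "\<And>t n. t \<in> T \<Longrightarrow> {\<omega> \<in> space M. Q t n \<omega>} \<in> events"
    and "\<And>t. t \<in> T \<Longrightarrow> (\<lambda>n. \<P>(\<omega> in M. Q t n \<omega>)) \<longlonglongrightarrow> 0"
  shows "(\<lambda>n. \<P>(\<omega> in M. \<exists>t\<in>T. Q t n \<omega>)) \<longlonglongrightarrow> 0"
proof (rule Lim_null_comparison)
  have "\<P>(\<omega> in M. \<exists>t\<in>T. Q t n \<omega>) \<le> (\<Sum>t\<in>T. \<P>(\<omega> in M. Q t n \<omega>))" for n
  proof -
    have "{\<omega> \<in> space M. \<exists>t\<in>T. Q t n \<omega>} = (\<Union>t\<in>T. {\<omega> \<in> space M. Q t n \<omega>})" by auto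
    moreover have "(\<lambda>t. {\<omega> \<in> space M. Q t n \<omega>}) ` T \<subseteq> events" using assms(2) by blast
    ultimately show ?thesis using finite_measure_subadditive_finite[OF assms(1)] by simp
  qed
  then show "\<forall>\<^sub>F n in sequentially. norm (\<P>(\<omega> in M. \<exists>t\<in>T. Q t n \<omega>)) \<le> (\<Sum>t\<in>T. \<P>(\<omega> in M. Q t n \<omega>))"
    by simp
  show "(\<lambda>n. \<Sum>t\<in>T. \<P>(\<omega> in M. Q t n \<omega>)) \<longlonglongrightarrow> 0"
    using assms(3) by (rule tendsto_null_sum)
qed

text \<open>The union over the finitely many false hypotheses is taken before the diagonal argument,
  so that one sequence serves all of them.\<close>

lemma (in prob_space) consistent_test_separating_sequence:
  fixes Y :: "nat \<Rightarrow> 'a \<Rightarrow> 'v::finite \<Rightarrow> nat" and P :: "('v \<Rightarrow> nat) pmf"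
    and pval :: "'v data \<Rightarrow> 'v set \<Rightarrow> 'v set \<Rightarrow> real"
  assumes Y: "\<And>m. Y m \<in> measurable M (count_space UNIV)" and test: "consistent_test M Y P pval"
  defines "pv \<equiv> \<lambda>(i, j, k) n \<omega>. pval (dataset Y n \<omega>) {i, j} k"
  defines "T \<equiv> {(i, j, k). i \<noteq> j \<and> k \<subseteq> UNIV - {i, j}}"
  defines "D \<equiv> {(i, j, k). (i, j, k) \<in> T \<and> \<not> cond_indep P {i} {j} k}"
  obtains a :: "nat \<Rightarrow> real" where "a \<longlonglongrightarrow> 0" "\<And>n. a n > 0"
    "(\<lambda>n. \<P>(\<omega> in M. \<exists>t\<in>D. a n < pv t n \<omega>)) \<longlonglongrightarrow> 0"
    "(\<lambda>n. \<P>(\<omega> in M. \<exists>t\<in>T - D. pv t n \<omega> \<le> a n)) \<longlonglongrightarrow> 0"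
proof -
  have pv_meas [measurable]: "pv t n \<in> borel_measurable M" for t n
    using measurable_compose[OF measurable_dataset[OF Y], of "\<lambda>d. pval d {fst t, fst (snd t)} (snd (snd t))"]
    by (simp add: pv_def case_prod_unfold)
  have null: "(\<lambda>n. \<P>(\<omega> in M. \<exists>t\<in>D. \<epsilon> < pv t n \<omega>)) \<longlonglongrightarrow> 0" if "\<epsilon> > 0" for \<epsilon>
  proof (rule prob_ex_null)
    fix t assume "t \<in> D"
    then obtain i j k where t: "t = (i, j, k)" "i \<noteq> j" "k \<subseteq> UNIV - {i, j}" "\<not> cond_indep P {i} {j} k"
      by (auto simp: D_def T_def)
    from t(2-4) have lim: "(\<lambda>n. \<P>(\<omega> in M. \<bar>pv t n \<omega>\<bar> > \<epsilon>)) \<longlonglongrightarrow> 0"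
      using test \<open>\<epsilon> > 0\<close> unfolding consistent_test_def pv_def t(1) prod.case by blast
    have "\<P>(\<omega> in M. \<epsilon> < pv t n \<omega>) \<le> \<P>(\<omega> in M. \<bar>pv t n \<omega>\<bar> > \<epsilon>)" for n
      by (intro finite_measure_mono) auto
    then show "(\<lambda>n. \<P>(\<omega> in M. \<epsilon> < pv t n \<omega>)) \<longlonglongrightarrow> 0"
      by (intro Lim_null_comparison[OF _ lim]) simp
  next
    show "finite D" by simp
    show "{\<omega> \<in> space M. \<epsilon> < pv t n \<omega>} \<in> events" for t n by measurable
  qed
  have "\<exists>a :: nat \<Rightarrow> real. a \<longlonglongrightarrow> 0 \<and> (\<forall>n. a n > 0) \<and>
      (\<lambda>n. \<P>(\<omega> in M. \<exists>t\<in>D. a n < pv t n \<omega>)) \<longlonglongrightarrow> 0"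
    by (rule diagonal_null_sequence) (rule null)
  then obtain a :: "nat \<Rightarrow> real" where
    a: "a \<longlonglongrightarrow> 0" "\<forall>n. a n > 0" "(\<lambda>n. \<P>(\<omega> in M. \<exists>t\<in>D. a n < pv t n \<omega>)) \<longlonglongrightarrow> 0"
    by (elim exE conjE)
  have "(\<lambda>n. \<P>(\<omega> in M. \<exists>t\<in>T - D. pv t n \<omega> \<le> a n)) \<longlonglongrightarrow> 0"
  proof (rule prob_ex_null)
    fix t assume "t \<in> T - D"
    then obtain i j k where t: "t = (i, j, k)" "i \<noteq> j" "k \<subseteq> UNIV - {i, j}" "cond_indep P {i} {j} k"
      by (auto simp: D_def T_def)
    then have "weak_conv_m (\<lambda>n. distr M borel (pv t n)) (uniform_measure lborel {0..1})"
      using test unfolding consistent_test_def pv_def by simp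
    then show "(\<lambda>n. \<P>(\<omega> in M. pv t n \<omega> \<le> a n)) \<longlonglongrightarrow> 0"
      by (intro weak_conv_uniform_prob_le_null a(1)) simp_all
  next
    show "finite (T - D)" by simp
    show "{\<omega> \<in> space M. pv t n \<omega> \<le> a n} \<in> events" for t n by measurable
  qed
  then show thesis using that[OF a(1) _ a(3)] a(2) by simp
qed

theorem theorem3:
  fixes M :: "'w measure"
    and Y :: "nat \<Rightarrow> 'w \<Rightarrow> 'v::finite \<Rightarrow> nat"
    and P :: "('v \<Rightarrow> nat) pmf"
    and r :: "'v \<Rightarrow> nat"
    and G0 :: "('v \<times> 'v) set"
    and Gstar :: "'v pdag"
    and pval :: "'v data \<Rightarrow> 'v set \<Rightarrow> 'v set \<Rightarrow> real"
    and \<phi> :: "('v \<times> 'v) set \<Rightarrow> 'v data \<Rightarrow> real"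
  assumes "discrete_distribution r P"
    and "acyclic G0" and "faithful P G0" and "Gstar = cpdag G0"
    and "prob_space M" and "iid_samples M Y P"
    and "decomposable_score \<phi>" and "score_equivalent \<phi>" and "consistent_score M Y P \<phi>"
    and "consistent_test M Y P pval"
  shows "(\<exists>a :: nat \<Rightarrow> real. a \<longlonglongrightarrow> 0 \<and>
      (\<forall>(\<alpha> :: nat \<Rightarrow> real) (Ghat :: nat \<Rightarrow> 'v data \<Rightarrow> 'v pdag).
         (\<forall>\<^sub>F n in sequentially. \<alpha> n \<ge> a n) \<longrightarrow>
         (\<forall>n d. length d = n \<longrightarrow> path_estimate pval \<phi> (\<alpha> n) d (Ghat n d)) \<longrightarrow>
         (\<lambda>n. \<P>(\<omega> in M. Ghat n (dataset Y n \<omega>) = Gstar)) \<longlonglongrightarrow> 1)) \<and>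
    (\<forall>(\<alpha> :: real) (Ghat :: nat \<Rightarrow> 'v data \<Rightarrow> 'v pdag).
         0 < \<alpha> \<longrightarrow> \<alpha> < 1 \<longrightarrow>
         (\<forall>n d. length d = n \<longrightarrow> path_estimate pval \<phi> \<alpha> d (Ghat n d)) \<longrightarrow>
         (\<lambda>n. \<P>(\<omega> in M. Ghat n (dataset Y n \<omega>) = Gstar)) \<longlonglongrightarrow> 1)"
proof -
  interpret prob_space M by fact
  have Y: "Y m \<in> measurable M (count_space UNIV)" for m
    using assms(6) unfolding iid_samples_def indep_vars_def by simp
  have event: "{\<omega> \<in> space M. Q (dataset Y n \<omega>)} \<in> events" for Q n
    using measurable_sets[OF measurable_dataset[where Y = Y, OF Y], of "{d. Q d}" n]
    by (simp add: vimage_def Int_def conj_commute)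
  define T where "T = {(i, j, k). i \<noteq> (j :: 'v) \<and> k \<subseteq> UNIV - {i, j}}"
  define D where "D = {(i, j, k). (i, j, k) \<in> T \<and> \<not> cond_indep P {i} {j} k}"
  define pv where "pv = (\<lambda>(i, j, k) d. pval d {i, j} k)"
  obtain a :: "nat \<Rightarrow> real" where a: "a \<longlonglongrightarrow> 0" "\<And>n. a n > 0"
    "(\<lambda>n. \<P>(\<omega> in M. \<exists>t\<in>D. a n < pv t (dataset Y n \<omega>))) \<longlonglongrightarrow> 0"
    "(\<lambda>n. \<P>(\<omega> in M. \<exists>t\<in>T - D. pv t (dataset Y n \<omega>) \<le> a n)) \<longlonglongrightarrow> 0"
    using consistent_test_separating_sequence[of Y P pval, OF Y assms(10)]
    unfolding T_def D_def pv_def by (auto simp: case_prod_unfold)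
  \<comment> \<open>The event involves \<open>a n\<close> but not the threshold, so one sequence
    serves all thresholds above it and all choices of outputs.\<close>
  define good where "good n d \<longleftrightarrow> (\<forall>t\<in>D. pv t d \<le> a n) \<and> (\<forall>t\<in>T - D. a n < pv t d) \<and>
    (\<forall>G. is_arg_max (\<lambda>H. \<phi> H d) acyclic G \<longrightarrow> markov_equivalent G0 G)" for n d
  have good_estimate: "G = Gstar"
    if "good n d" "a n \<le> \<alpha>" "path_estimate pval \<phi> \<alpha> d G" for n d \<alpha> G
    unfolding assms(4)
  proof (rule path_estimate_eq_cpdag[OF assms(2) less_imp_le[OF a(2)] that(2) _ _ assms(8) _ that(3)])
    have ci: "cond_indep P {i} {j} k \<longleftrightarrow> \<not> d_connected G0 k i j"
      if "i \<noteq> j" "k \<subseteq> UNIV - {i, j}" for i j k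
      using assms(3)[unfolded faithful_def, rule_format, of "{i}" "{j}" k]
        d_separated_iff_not_d_connected[OF assms(2), of "{i}" k "{j}"] that by auto
    show "pval d {i, j} k \<le> a n" if "i \<noteq> j" "k \<subseteq> UNIV - {i, j}" "d_connected G0 k i j" for i j k
    proof -
      have "(i, j, k) \<in> D" using that ci[of i j k] by (simp add: D_def T_def)
      then have "pv (i, j, k) d \<le> a n" using \<open>good n d\<close> unfolding good_def by blast
      then show ?thesis by (simp add: pv_def)
    qed
    show "a n < pval d {i, j} k" if "i \<noteq> j" "k \<subseteq> UNIV - {i, j}" "\<not> d_connected G0 k i j" for i j k
    proof -
      have "(i, j, k) \<in> T - D" using that ci[of i j k] by (simp add: D_def T_def)
      then have "a n < pv (i, j, k) d" using \<open>good n d\<close> unfolding good_def by blast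
      then show ?thesis by (simp add: pv_def)
    qed
    show "markov_equivalent G0 G'" if "is_arg_max (\<lambda>G. \<phi> G d) acyclic G'" for G'
      using \<open>good n d\<close> that unfolding good_def by blast
  qed
  have score: "(\<lambda>n. \<P>(\<omega> in M. \<forall>G. is_arg_max (\<lambda>H. \<phi> H (dataset Y n \<omega>)) acyclic G
      \<longrightarrow> markov_equivalent G0 G)) \<longlonglongrightarrow> 1" (is "(\<lambda>n. \<P>(\<omega> in M. ?score n \<omega>)) \<longlonglongrightarrow> 1")
    using assms(2,3,9) unfolding consistent_score_def by blast
  have good_lower: "\<P>(\<omega> in M. ?score n \<omega>) - \<P>(\<omega> in M. \<exists>t\<in>D. a n < pv t (dataset Y n \<omega>))
      - \<P>(\<omega> in M. \<exists>t\<in>T - D. pv t (dataset Y n \<omega>) \<le> a n) \<le> \<P>(\<omega> in M. good n (dataset Y n \<omega>))" for n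
  proof -
    let ?A = "{\<omega> \<in> space M. \<exists>t\<in>D. a n < pv t (dataset Y n \<omega>)}"
    let ?B = "{\<omega> \<in> space M. \<exists>t\<in>T - D. pv t (dataset Y n \<omega>) \<le> a n}"
    let ?G = "{\<omega> \<in> space M. good n (dataset Y n \<omega>)}"
    have ev: "?A \<in> events" "?B \<in> events" "?G \<in> events"
      using event[of "\<lambda>d. \<exists>t\<in>D. a n < pv t d" n] event[of "\<lambda>d. \<exists>t\<in>T - D. pv t d \<le> a n" n]
        event[of "good n" n] by blast+
    have "{\<omega> \<in> space M. ?score n \<omega>} \<subseteq> ?G \<union> (?A \<union> ?B)"
      unfolding good_def by (auto simp: not_le not_less)
    then have "prob {\<omega> \<in> space M. ?score n \<omega>} \<le> prob (?G \<union> (?A \<union> ?B))"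
      using ev by (intro finite_measure_mono) auto
    also have "\<dots> \<le> prob ?G + (prob ?A + prob ?B)"
      using ev measure_Un_le[of ?G M "?A \<union> ?B"] measure_Un_le[of ?A M ?B] by (simp add: sets.Un)
    finally show ?thesis by simp
  qed
  have lim: "(\<lambda>n. \<P>(\<omega> in M. Ghat n (dataset Y n \<omega>) = Gstar)) \<longlonglongrightarrow> 1"
    if ev: "\<forall>\<^sub>F n in sequentially. \<alpha> n \<ge> a n"
      and est: "\<forall>n d. length d = n \<longrightarrow> path_estimate pval \<phi> (\<alpha> n) d (Ghat n d)"
    for \<alpha> :: "nat \<Rightarrow> real" and Ghat
  proof (rule tendsto_sandwich[where h = "\<lambda>_. 1"])
    show "\<forall>\<^sub>F n in sequentially. \<P>(\<omega> in M. ?score n \<omega>)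
        - \<P>(\<omega> in M. \<exists>t\<in>D. a n < pv t (dataset Y n \<omega>))
        - \<P>(\<omega> in M. \<exists>t\<in>T - D. pv t (dataset Y n \<omega>) \<le> a n)
      \<le> \<P>(\<omega> in M. Ghat n (dataset Y n \<omega>) = Gstar)"
      using ev
    proof eventually_elim
      case (elim n)
      have "Ghat n (dataset Y n \<omega>) = Gstar" if "good n (dataset Y n \<omega>)" for \<omega>
        using good_estimate[OF that elim est[rule_format]] by (simp add: dataset_def)
      then have "\<P>(\<omega> in M. good n (dataset Y n \<omega>)) \<le> \<P>(\<omega> in M. Ghat n (dataset Y n \<omega>) = Gstar)"
        using event[of "\<lambda>d. Ghat n d = Gstar" n] by (intro finite_measure_mono) auto
      with good_lower[of n] show ?case by simp
    qed
    show "(\<lambda>n. \<P>(\<omega> in M. ?score n \<omega>) - \<P>(\<omega> in M. \<exists>t\<in>D. a n < pv t (dataset Y n \<omega>))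
        - \<P>(\<omega> in M. \<exists>t\<in>T - D. pv t (dataset Y n \<omega>) \<le> a n)) \<longlonglongrightarrow> 1"
      using tendsto_diff[OF tendsto_diff[OF score a(3)] a(4)] by simp
  qed simp_all
  show ?thesis
  proof (intro conjI exI[of _ a] allI impI)
    show "a \<longlonglongrightarrow> 0" by (rule a(1))
  next
    fix \<alpha> :: "nat \<Rightarrow> real" and Ghat
    assume "\<forall>\<^sub>F n in sequentially. \<alpha> n \<ge> a n"
      and est: "\<forall>n d. length d = n \<longrightarrow> path_estimate pval \<phi> (\<alpha> n) d (Ghat n d)"
    then show "(\<lambda>n. \<P>(\<omega> in M. Ghat n (dataset Y n \<omega>) = Gstar)) \<longlonglongrightarrow> 1"
      by (rule lim)
  next
    fix \<alpha> :: real and Ghat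
    assume "0 < \<alpha>"
      and est: "\<forall>n d. length d = n \<longrightarrow> path_estimate pval \<phi> \<alpha> d (Ghat n d)"
    have "\<forall>\<^sub>F n in sequentially. a n \<le> \<alpha>"
      using order_tendstoD(2)[OF a(1) \<open>0 < \<alpha>\<close>] by (rule eventually_mono) simp
    then show "(\<lambda>n. \<P>(\<omega> in M. Ghat n (dataset Y n \<omega>) = Gstar)) \<longlonglongrightarrow> 1"
      using est by (rule lim)
  qed
qed

end
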